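(* Let $B$ be a finite-dimensional $C^*$-algebra with faithful state $\psi$, and let $C$ be an arbitrary $C^*$-algebra. The map $\Psi':\mathcal B(B,C)\to C\otimes B^{\mathrm{op}}$ determined by linearity by $\theta_{\psi a,c}\mapsto c\otimes\sigma_{-i/2}(a)$ ($a\in B$, $c\in C$) restricts to a bijection between the completely positive maps $B\to C$ and the positive elements $e\in C\otimes B^{\mathrm{op}}$.
   Context: $\mathrm{Tr}$ is the sum of the non-normalised traces of the matrix blocks of $B$, $Q\in B$ is the positive invertible element with $\psi(a)=\mathrm{Tr}(Qa)$, and $\sigma_z(a)=Q^{iz}aQ^{-iz}$ for $z\in\mathbb C$, $a\in B$. $B^{\mathrm{op}}$ is the $C^*$-algebra $B$ with the same $*$-vector space structure and reversed product. For $a\in B$, $c\in C$, $\theta_{\psi a,c}\in\mathcal B(B,C)$ is the linear map $b\mapsto\psi(ab)c$; every linear map $B\to C$ is a finite sum of such maps, since every functional on $B$ has the form $b\mapsto\psi(ab)$ for a unique $a\in B$. *)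

theory Defs
  imports Complex_Main "HOL-Library.Multiset" "HOL-Library.FuncSet" "HOL-Library.Complex_Order"
    "Jordan_Normal_Form.Matrix"
begin

section \<open>Complex *-algebras and C*-algebras\<close>

class scaleC =
  fixes scaleC :: "complex \<Rightarrow> 'a \<Rightarrow> 'a"  (infixr "*\<^sub>C" 75)

class complex_vector = scaleC + ab_group_add +
  assumes scaleC_add_right: "z *\<^sub>C (x + y) = z *\<^sub>C x + z *\<^sub>C y"
    and scaleC_add_left: "(z + w) *\<^sub>C x = z *\<^sub>C x + w *\<^sub>C x"
    and scaleC_scaleC: "z *\<^sub>C (w *\<^sub>C x) = (z * w) *\<^sub>C x"
    and scaleC_one: "1 *\<^sub>C x = x"

abbreviation clinear :: "('a::complex_vector \<Rightarrow> 'b::complex_vector) \<Rightarrow> bool"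
  where "clinear \<equiv> Vector_Spaces.linear scaleC scaleC"

abbreviation cspan :: "'a::complex_vector set \<Rightarrow> 'a set"
  where "cspan \<equiv> module.span scaleC"

lemma vector_space_scaleC: "vector_space (scaleC :: complex \<Rightarrow> 'a::complex_vector \<Rightarrow> 'a)"
  by unfold_locales (simp_all add: scaleC_add_right scaleC_add_left scaleC_scaleC scaleC_one)

lemma scaleC_zero_right [simp]: "z *\<^sub>C (0 :: 'a::complex_vector) = 0"
  using scaleC_add_right[of z "0::'a" 0] by simp

lemma scaleC_minus_one: "(- 1) *\<^sub>C x = - (x :: 'a::complex_vector)"
proof -
  have "0 *\<^sub>C x = 0"
    using scaleC_add_left[of 0 0 x] by simp
  then have "x + (- 1) *\<^sub>C x = 0"
    using scaleC_add_left[of 1 "- 1" x] by (simp add: scaleC_one)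
  then show ?thesis
    by (simp add: eq_neg_iff_add_eq_0 add.commute)
qed

text \<open>Not necessarily unital.\<close>

class star_algebra = complex_vector + Rings.ring +
  fixes star :: "'a \<Rightarrow> 'a"
  assumes scaleC_mult_left: "(z *\<^sub>C x) * y = z *\<^sub>C (x * y)"
    and scaleC_mult_right: "x * (z *\<^sub>C y) = z *\<^sub>C (x * y)"
    and star_star [simp]: "star (star x) = x"
    and star_add: "star (x + y) = star x + star y"
    and star_scaleC: "star (z *\<^sub>C x) = cnj z *\<^sub>C star x"
    and star_mult: "star (x * y) = star y * star x"

lemma star_zero [simp]: "star (0 :: 'a::star_algebra) = 0"
  using star_add[of "0::'a" 0] by simp

class cstar_algebra = star_algebra + banach + real_normed_algebra +
  assumes scaleR_scaleC: "r *\<^sub>R x = complex_of_real r *\<^sub>C x"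
    and norm_scaleC: "norm (z *\<^sub>C x) = cmod z * norm x"
    and cstar_identity: "norm (star x * x) = (norm x)\<^sup>2"

class cstar_algebra_1 = cstar_algebra + real_normed_algebra_1

instantiation complex :: cstar_algebra_1
begin
definition scaleC_complex :: "complex \<Rightarrow> complex \<Rightarrow> complex"
  where [simp]: "scaleC_complex z w = z * w"
definition star_complex :: "complex \<Rightarrow> complex"
  where [simp]: "star_complex = cnj"
instance
  by standard (simp_all add: algebra_simps norm_mult power2_eq_square scaleR_conv_of_real)
end

definition positive :: "'a::star_algebra \<Rightarrow> bool"
  where "positive a \<longleftrightarrow> (\<exists>x. a = star x * x)"

definition finite_dim :: "'a::complex_vector itself \<Rightarrow> bool"
  where "finite_dim _ \<longleftrightarrow> (\<exists>S :: 'a set. finite S \<and> cspan S = UNIV)"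

definition faithful_state :: "('a::cstar_algebra_1 \<Rightarrow> complex) \<Rightarrow> bool"
  where "faithful_state \<psi> \<longleftrightarrow> clinear \<psi> \<and> (\<forall>a. 0 \<le> \<psi> (star a * a)) \<and> \<psi> 1 = 1
    \<and> (\<forall>a. \<psi> (star a * a) = 0 \<longrightarrow> a = 0)"


section \<open>Completely positive maps\<close>

definition mat_star :: "'a::star_algebra mat \<Rightarrow> 'a mat"
  where "mat_star A = map_mat star (transpose_mat A)"

text \<open>Positivity in the *-algebra \<open>M\<^sub>n(A)\<close>.\<close>

definition positive_mat :: "nat \<Rightarrow> 'a::star_algebra mat \<Rightarrow> bool"
  where "positive_mat n A \<longleftrightarrow> (\<exists>X \<in> carrier_mat n n. A = mat_star X * X)"

definition completely_positive :: "('a::star_algebra \<Rightarrow> 'b::star_algebra) \<Rightarrow> bool"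
  where "completely_positive T \<longleftrightarrow> clinear T \<and>
    (\<forall>n. \<forall>A \<in> carrier_mat n n. positive_mat n A \<longrightarrow> positive_mat n (map_mat T A))"


section \<open>Matrix blocks, trace and modular group\<close>

definition mat_trace :: "complex mat \<Rightarrow> complex"
  where "mat_trace A = (\<Sum>i<dim_row A. A $$ (i, i))"

text \<open>\<open>\<phi>\<close> is a *-isomorphism of the algebra onto the direct sum of the full matrix algebras of
  sizes \<open>d 0, \<dots>, d (r - 1)\<close>; \<open>\<phi> a k\<close> is the \<open>k\<close>-th block of \<open>a\<close>.\<close>

definition block_isomorphism ::
    "nat \<Rightarrow> (nat \<Rightarrow> nat) \<Rightarrow> ('a::star_algebra \<Rightarrow> nat \<Rightarrow> complex mat) \<Rightarrow> bool"
  where "block_isomorphism r d \<phi> \<longleftrightarrow>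
    (\<forall>k<r. 0 < d k) \<and>
    bij_betw \<phi> UNIV (\<Pi>\<^sub>E k \<in> {..<r}. carrier_mat (d k) (d k)) \<and>
    (\<forall>k<r. (\<forall>a b. \<phi> (a + b) k = \<phi> a k + \<phi> b k) \<and>
           (\<forall>z a. \<phi> (z *\<^sub>C a) k = z \<cdot>\<^sub>m \<phi> a k) \<and>
           (\<forall>a b. \<phi> (a * b) k = \<phi> a k * \<phi> b k) \<and>
           (\<forall>a. \<phi> (star a) k = mat_star (\<phi> a k)))"

text \<open>The sum of the non-normalised traces of the matrix blocks. (Any two block decompositions of a
  finite-dimensional C*-algebra yield the same functional.)\<close>

definition is_block_trace :: "('a::star_algebra \<Rightarrow> complex) \<Rightarrow> bool"
  where "is_block_trace Tr \<longleftrightarrow>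
    (\<exists>r d \<phi>. block_isomorphism r d \<phi> \<and> (\<forall>a. Tr a = (\<Sum>k<r. mat_trace (\<phi> a k))))"

text \<open>For positive invertible \<open>Q\<close>: the logarithm is the unique self-adjoint \<open>h\<close> with \<open>exp h = Q\<close>,
  and \<open>Q\<^sup>w = exp (w log Q)\<close>.\<close>

definition clog :: "'a::cstar_algebra_1 \<Rightarrow> 'a"
  where "clog Q = (THE h. star h = h \<and> exp h = Q)"

definition cpow :: "'a::cstar_algebra_1 \<Rightarrow> complex \<Rightarrow> 'a"
  where "cpow Q w = exp (w *\<^sub>C clog Q)"

definition modular :: "'a::cstar_algebra_1 \<Rightarrow> complex \<Rightarrow> 'a \<Rightarrow> 'a"
  where "modular Q z a = cpow Q (\<i> * z) * a * cpow Q (- \<i> * z)"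


section \<open>The opposite algebra\<close>

datatype 'a opp = Opp (unopp: 'a)

instantiation opp :: (star_algebra) star_algebra
begin
definition zero_opp :: "'a opp" where "0 = Opp 0"
definition plus_opp :: "'a opp \<Rightarrow> 'a opp \<Rightarrow> 'a opp" where "x + y = Opp (unopp x + unopp y)"
definition minus_opp :: "'a opp \<Rightarrow> 'a opp \<Rightarrow> 'a opp" where "x - y = Opp (unopp x - unopp y)"
definition uminus_opp :: "'a opp \<Rightarrow> 'a opp" where "- x = Opp (- unopp x)"
definition scaleC_opp :: "complex \<Rightarrow> 'a opp \<Rightarrow> 'a opp" where "z *\<^sub>C x = Opp (z *\<^sub>C unopp x)"
definition star_opp :: "'a opp \<Rightarrow> 'a opp" where "star x = Opp (star (unopp x))"
definition times_opp :: "'a opp \<Rightarrow> 'a opp \<Rightarrow> 'a opp" where "x * y = Opp (unopp y * unopp x)"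
instance
  by standard
    (simp_all add: zero_opp_def plus_opp_def minus_opp_def uminus_opp_def scaleC_opp_def
      star_opp_def times_opp_def scaleC_add_right scaleC_add_left scaleC_scaleC scaleC_one
      scaleC_mult_left scaleC_mult_right star_add star_scaleC star_mult algebra_simps)
end


section \<open>The algebraic tensor product over the complex numbers\<close>

text \<open>Finite formal sums of pairs modulo the congruence generated by bilinearity. If one of the two
  factors is a finite-dimensional C*-algebra and the other is a C*-algebra, the algebraic tensor
  product is complete for its unique C*-norm, so that it is the C*-algebraic tensor product.
  The norm is not needed in order to speak of its positive elements.\<close>

inductive tensor_eq ::
    "('a::complex_vector \<times> 'b::complex_vector) multiset \<Rightarrow> ('a \<times> 'b) multiset \<Rightarrow> bool" where
  tensor_refl: "tensor_eq M M"
| tensor_sym: "tensor_eq M N \<Longrightarrow> tensor_eq N M"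
| tensor_trans: "tensor_eq M N \<Longrightarrow> tensor_eq N K \<Longrightarrow> tensor_eq M K"
| tensor_cong: "tensor_eq M N \<Longrightarrow> tensor_eq (M + K) (N + K)"
| tensor_add_left: "tensor_eq {#(a + a', b)#} {#(a, b), (a', b)#}"
| tensor_add_right: "tensor_eq {#(a, b + b')#} {#(a, b), (a, b')#}"
| tensor_scale: "tensor_eq {#(z *\<^sub>C a, b)#} {#(a, z *\<^sub>C b)#}"
| tensor_zero: "tensor_eq {#(0, b)#} {#}"

lemma tensor_cong2:
  assumes "tensor_eq M M'" and "tensor_eq N N'" shows "tensor_eq (M + N) (M' + N')"
  by (metis assms tensor_cong tensor_trans add.commute)

lemma tensor_zero_right: "tensor_eq {#(a, 0)#} {#}"
proof -
  have "tensor_eq {#(0 *\<^sub>C a, 0)#} {#(a, 0 *\<^sub>C 0)#}"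
    by (rule tensor_scale)
  moreover have "0 *\<^sub>C a = 0"
    using scaleC_add_left[of 0 0 a] by simp
  ultimately show ?thesis
    by (metis scaleC_zero_right tensor_sym tensor_trans tensor_zero)
qed

lemma tensor_eq_sum:
  assumes "tensor_eq M N"
    and "\<And>a a' b. tensor_eq (f (a + a', b)) (f (a, b) + f (a', b))"
    and "\<And>a b b'. tensor_eq (f (a, b + b')) (f (a, b) + f (a, b'))"
    and "\<And>z a b. tensor_eq (f (z *\<^sub>C a, b)) (f (a, z *\<^sub>C b))"
    and "\<And>b. tensor_eq (f (0, b)) {#}"
  shows "tensor_eq (\<Sum>p\<in>#M. f p) (\<Sum>p\<in>#N. f p)"
  using assms(1)
  by induction (auto intro: assms(2-) tensor_refl tensor_cong dest: tensor_sym tensor_trans)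

lemma tensor_eq_sum_cong:
  assumes "\<And>p. tensor_eq (f p) (g p)"
  shows "tensor_eq (\<Sum>p\<in>#M. f p) (\<Sum>p\<in>#M. g p)"
  by (induction M) (auto intro: tensor_refl tensor_cong2 assms)

quotient_type (overloaded) ('a, 'b) tensor =
  "('a::complex_vector \<times> 'b::complex_vector) multiset" / tensor_eq
  by (rule equivpI) (auto intro: reflpI sympI transpI tensor_refl tensor_sym tensor_trans)

lift_definition tensor_elem :: "'a::complex_vector \<Rightarrow> 'b::complex_vector \<Rightarrow> ('a, 'b) tensor"
    (infixr "\<otimes>\<^sub>t" 71)
  is "\<lambda>a b. {#(a, b)#}" .

lemma tensor_add_left2:
  "tensor_eq {#(a + a', b)#} ({#(a, b)#} + {#(a', b)#})"
  "tensor_eq {#(a, b + b')#} ({#(a, b)#} + {#(a, b')#})"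
  using tensor_add_left[of a a' b] tensor_add_right[of a b b'] by (simp_all add: add_mset_commute)

lemma tensor_eq_sum_add:
  assumes "\<And>p. tensor_eq (f p) (g p + h p)"
  shows "tensor_eq (\<Sum>p\<in>#M. f p) ((\<Sum>p\<in>#M. g p) + (\<Sum>p\<in>#M. h p))"
proof -
  have "tensor_eq (\<Sum>p\<in>#M. f p) (\<Sum>p\<in>#M. g p + h p)"
    by (rule tensor_eq_sum_cong) (rule assms)
  then show ?thesis by (simp add: sum_mset.distrib)
qed

instantiation tensor :: (complex_vector, complex_vector) complex_vector
begin

lift_definition zero_tensor :: "('a, 'b) tensor" is "{#}" .

lift_definition plus_tensor :: "('a, 'b) tensor \<Rightarrow> ('a, 'b) tensor \<Rightarrow> ('a, 'b) tensor" is "(+)"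
  by (rule tensor_cong2)

lift_definition scaleC_tensor :: "complex \<Rightarrow> ('a, 'b) tensor \<Rightarrow> ('a, 'b) tensor"
  is "\<lambda>z M. \<Sum>p\<in>#M. {#(z *\<^sub>C fst p, snd p)#}"
proof (erule tensor_eq_sum; unfold fst_conv snd_conv)
  fix z w and a a' :: 'a and b b' :: 'b
  show "tensor_eq {#(z *\<^sub>C (a + a'), b)#} ({#(z *\<^sub>C a, b)#} + {#(z *\<^sub>C a', b)#})"
    unfolding scaleC_add_right by (rule tensor_add_left2)
  show "tensor_eq {#(z *\<^sub>C a, b + b')#} ({#(z *\<^sub>C a, b)#} + {#(z *\<^sub>C a, b')#})"
    by (rule tensor_add_left2)
  show "tensor_eq {#(z *\<^sub>C (w *\<^sub>C a), b)#} {#(z *\<^sub>C a, w *\<^sub>C b)#}"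
    using tensor_scale[of w "z *\<^sub>C a" b] by (simp add: scaleC_scaleC mult.commute)
  show "tensor_eq {#(z *\<^sub>C (0::'a), b)#} {#}"
    by (simp add: tensor_zero)
qed

definition uminus_tensor :: "('a, 'b) tensor \<Rightarrow> ('a, 'b) tensor"
  where "- x = (- 1) *\<^sub>C (x :: ('a, 'b) tensor)"

definition minus_tensor :: "('a, 'b) tensor \<Rightarrow> ('a, 'b) tensor \<Rightarrow> ('a, 'b) tensor"
  where "x - y = x + - (y :: ('a, 'b) tensor)"

instance
proof
  fix x y t :: "('a, 'b) tensor" and z w :: complex
  show "x + y + t = x + (y + t)"
    by transfer (simp add: tensor_refl add.assoc)
  show "x + y = y + x"
    by transfer (simp add: tensor_refl add.commute)
  show "0 + x = x"
    by transfer (simp add: tensor_refl)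
  show one: "1 *\<^sub>C x = x"
    by transfer (simp add: tensor_refl scaleC_one)
  show "z *\<^sub>C (x + y) = z *\<^sub>C x + z *\<^sub>C y"
    by transfer (simp add: tensor_refl)
  show add: "(z + w) *\<^sub>C x = z *\<^sub>C x + w *\<^sub>C x" for z w
    by transfer (rule tensor_eq_sum_add, unfold scaleC_add_left, rule tensor_add_left2)
  show "z *\<^sub>C (w *\<^sub>C x) = (z * w) *\<^sub>C x"
    by transfer (simp add: tensor_refl scaleC_scaleC image_mset.compositionality o_def)
  have "0 *\<^sub>C a = (0::'a)" for a
    using scaleC_add_left[of 0 0 a] by simp
  then have "0 *\<^sub>C x = 0"
  proof (transfer)
    fix M :: "('a \<times> 'b) multiset"
    assume *: "\<And>a::'a. 0 *\<^sub>C a = 0"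
    have "tensor_eq (\<Sum>p\<in>#M. {#(0 *\<^sub>C fst p, snd p)#}) (\<Sum>p\<in>#M. {#})"
      by (rule tensor_eq_sum_cong) (simp add: * tensor_zero)
    then show "tensor_eq (\<Sum>p\<in>#M. {#(0 *\<^sub>C fst p, snd p)#}) {#}"
      by simp
  qed
  then show "- x + x = 0"
    unfolding uminus_tensor_def using add[of "- 1" 1] one by simp
  show "x - y = x + - y"
    by (rule minus_tensor_def)
qed

end

lemma tensor_elem_bilinear:
  "(a + a') \<otimes>\<^sub>t b = a \<otimes>\<^sub>t b + a' \<otimes>\<^sub>t b"
  "a \<otimes>\<^sub>t (b + b') = a \<otimes>\<^sub>t b + a \<otimes>\<^sub>t b'"
  "(z *\<^sub>C a) \<otimes>\<^sub>t b = z *\<^sub>C (a \<otimes>\<^sub>t b)"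
  "a \<otimes>\<^sub>t (z *\<^sub>C b) = z *\<^sub>C (a \<otimes>\<^sub>t b)"
proof -
  show "(a + a') \<otimes>\<^sub>t b = a \<otimes>\<^sub>t b + a' \<otimes>\<^sub>t b"
    by transfer (rule tensor_add_left2)
  show "a \<otimes>\<^sub>t (b + b') = a \<otimes>\<^sub>t b + a \<otimes>\<^sub>t b'"
    by transfer (rule tensor_add_left2)
  show "(z *\<^sub>C a) \<otimes>\<^sub>t b = z *\<^sub>C (a \<otimes>\<^sub>t b)"
    by transfer (simp add: tensor_refl)
  show "a \<otimes>\<^sub>t (z *\<^sub>C b) = z *\<^sub>C (a \<otimes>\<^sub>t b)"
    by transfer (simp add: tensor_scale tensor_sym)
qed

text \<open>The product and the involution are determined by
  \<open>(a \<otimes>\<^sub>t b) * (a' \<otimes>\<^sub>t b') = (a * a') \<otimes>\<^sub>t (b * b')\<close> and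
  \<open>star (a \<otimes>\<^sub>t b) = star a \<otimes>\<^sub>t star b\<close>.\<close>

instantiation tensor :: (star_algebra, star_algebra) star_algebra
begin

lift_definition times_tensor :: "('a, 'b) tensor \<Rightarrow> ('a, 'b) tensor \<Rightarrow> ('a, 'b) tensor"
  is "\<lambda>M N. \<Sum>p\<in>#M. \<Sum>q\<in>#N. {#(fst p * fst q, snd p * snd q)#}"
proof -
  fix M M' N N' :: "('a \<times> 'b) multiset"
  assume M: "tensor_eq M M'" and N: "tensor_eq N N'"
  let ?f = "\<lambda>N p. \<Sum>q\<in>#N. {#(fst p * fst q, snd p * snd q)#}"
  have *: "tensor_eq (?f N p) (?f N' p)" for p
    using N
  proof (rule tensor_eq_sum; unfold fst_conv snd_conv)
    fix z and a a' :: 'a and b b' :: 'b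
    show "tensor_eq {#(fst p * (a + a'), snd p * b)#}
        ({#(fst p * a, snd p * b)#} + {#(fst p * a', snd p * b)#})"
      unfolding distrib_left by (rule tensor_add_left2)
    show "tensor_eq {#(fst p * a, snd p * (b + b'))#}
        ({#(fst p * a, snd p * b)#} + {#(fst p * a, snd p * b')#})"
      unfolding distrib_left by (rule tensor_add_left2)
    show "tensor_eq {#(fst p * z *\<^sub>C a, snd p * b)#} {#(fst p * a, snd p * z *\<^sub>C b)#}"
      unfolding scaleC_mult_right by (rule tensor_scale)
    show "tensor_eq {#(fst p * 0, snd p * b)#} {#}"
      by (simp add: tensor_zero)
  qed
  have "tensor_eq (\<Sum>p\<in>#M. ?f N p) (\<Sum>p\<in>#M'. ?f N p)"
    using M
  proof (rule tensor_eq_sum)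
    fix z and a a' :: 'a and b b' :: 'b
    show "tensor_eq (?f N (a + a', b)) (?f N (a, b) + ?f N (a', b))"
      by (rule tensor_eq_sum_add, unfold fst_conv snd_conv distrib_right, rule tensor_add_left2)
    show "tensor_eq (?f N (a, b + b')) (?f N (a, b) + ?f N (a, b'))"
      by (rule tensor_eq_sum_add, unfold fst_conv snd_conv distrib_right, rule tensor_add_left2)
    show "tensor_eq (?f N (z *\<^sub>C a, b)) (?f N (a, z *\<^sub>C b))"
      by (rule tensor_eq_sum_cong, unfold fst_conv snd_conv scaleC_mult_left, rule tensor_scale)
    have "tensor_eq (?f N (0, b)) (\<Sum>q\<in>#N. {#})"
      by (rule tensor_eq_sum_cong) (simp add: tensor_zero)
    then show "tensor_eq (?f N (0, b)) {#}" by simp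
  qed
  moreover have "tensor_eq (\<Sum>p\<in>#M'. ?f N p) (\<Sum>p\<in>#M'. ?f N' p)"
    by (rule tensor_eq_sum_cong) (rule *)
  ultimately show "tensor_eq (\<Sum>p\<in>#M. ?f N p) (\<Sum>p\<in>#M'. ?f N' p)"
    by (rule tensor_trans)
qed

lift_definition star_tensor :: "('a, 'b) tensor \<Rightarrow> ('a, 'b) tensor"
  is "\<lambda>M. \<Sum>p\<in>#M. {#(star (fst p), star (snd p))#}"
proof (erule tensor_eq_sum; unfold fst_conv snd_conv)
  fix z and a a' :: 'a and b b' :: 'b
  show "tensor_eq {#(star (a + a'), star b)#} ({#(star a, star b)#} + {#(star a', star b)#})"
    unfolding star_add by (rule tensor_add_left2)
  show "tensor_eq {#(star a, star (b + b'))#} ({#(star a, star b)#} + {#(star a, star b')#})"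
    unfolding star_add by (rule tensor_add_left2)
  show "tensor_eq {#(star (z *\<^sub>C a), star b)#} {#(star a, star (z *\<^sub>C b))#}"
    unfolding star_scaleC by (rule tensor_scale)
  show "tensor_eq {#(star (0::'a), star b)#} {#}"
    by (simp add: tensor_zero)
qed

instance
proof
  fix x y t :: "('a, 'b) tensor" and z :: complex
  have sum_sum: "(\<Sum>p\<in>#M. \<Sum>q\<in>#N. {#f p q#}) = (\<Sum>q\<in>#N. \<Sum>p\<in>#M. {#f p q#})"
    for M N and f :: "'a \<times> 'b \<Rightarrow> 'a \<times> 'b \<Rightarrow> 'a \<times> 'b"
    by (rule sum_mset.swap)
  have img: "(\<Sum>p\<in>#(\<Sum>q\<in>#N. g q). f p) = (\<Sum>q\<in>#N. \<Sum>p\<in>#g q. f p)"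
    for N and g :: "'a \<times> 'b \<Rightarrow> ('a \<times> 'b) multiset" and f :: "'a \<times> 'b \<Rightarrow> ('a \<times> 'b) multiset"
    by (induction N) simp_all
  show "x * y * t = x * (y * t)"
    by transfer (simp add: tensor_refl img mult.assoc del: sum_mset_singleton_mset)
  show "(x + y) * t = x * t + y * t"
    by transfer (simp add: tensor_refl)
  show "x * (y + t) = x * y + x * t"
    by transfer (simp add: tensor_refl sum_mset.distrib)
  show "z *\<^sub>C x * y = z *\<^sub>C (x * y)"
    by transfer (simp add: tensor_refl img scaleC_mult_left del: sum_mset_singleton_mset)
  show "x * z *\<^sub>C y = z *\<^sub>C (x * y)"
  proof transfer
    fix z and M N :: "('a \<times> 'b) multiset"
    show "tensor_eq (\<Sum>p\<in>#M. \<Sum>q\<in>#(\<Sum>p\<in>#N. {#(z *\<^sub>C fst p, snd p)#}).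
           {#(fst p * fst q, snd p * snd q)#})
         (\<Sum>p\<in>#(\<Sum>p\<in>#M. \<Sum>q\<in>#N. {#(fst p * fst q, snd p * snd q)#}). {#(z *\<^sub>C fst p, snd p)#})"
      by (simp add: tensor_refl img scaleC_mult_right del: sum_mset_singleton_mset)
  qed
  show "star (star x) = x"
  proof transfer
    fix M :: "('a \<times> 'b) multiset"
    have "(\<Sum>p\<in>#(\<Sum>p\<in>#M. {#(star (fst p), star (snd p))#}). {#(star (fst p), star (snd p))#}) = M"
      by (induction M) simp_all
    then show "tensor_eq (\<Sum>p\<in>#(\<Sum>p\<in>#M. {#(star (fst p), star (snd p))#}).
        {#(star (fst p), star (snd p))#}) M"
      by (simp only: tensor_refl)
  qed
  show "star (x + y) = star x + star y"
    by transfer (simp add: tensor_refl)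
  show "star (z *\<^sub>C x) = cnj z *\<^sub>C star x"
    by transfer (simp add: tensor_refl img star_scaleC del: sum_mset_singleton_mset)
  show "star (x * y) = star y * star x"
  proof transfer
    fix M N :: "('a \<times> 'b) multiset"
    show "tensor_eq
       (\<Sum>p\<in>#(\<Sum>p\<in>#M. \<Sum>q\<in>#N. {#(fst p * fst q, snd p * snd q)#}). {#(star (fst p), star (snd p))#})
       (\<Sum>p\<in>#(\<Sum>p\<in>#N. {#(star (fst p), star (snd p))#}).
          \<Sum>q\<in>#(\<Sum>p\<in>#M. {#(star (fst p), star (snd p))#}). {#(fst p * fst q, snd p * snd q)#})"
      using sum_sum[of "\<lambda>p q. (star (fst q) * star (fst p), star (snd q) * star (snd p))" N M]
      by (simp add: tensor_refl img star_mult del: sum_mset_singleton_mset)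
  qed
qed

end

lemma tensor_elem_mult_star:
  "(a \<otimes>\<^sub>t b) * (a' \<otimes>\<^sub>t b') = (a * a') \<otimes>\<^sub>t (b * b')"
  "star (a \<otimes>\<^sub>t b) = star a \<otimes>\<^sub>t star b"
  by (transfer, simp add: tensor_refl)+


section \<open>The space of bounded complex-linear maps\<close>

lemma clinear_iff:
  "clinear T \<longleftrightarrow> (\<forall>x y. T (x + y) = T x + T y) \<and> (\<forall>z x. T (z *\<^sub>C x) = z *\<^sub>C T x)"
  by (simp add: Vector_Spaces.linear_iff vector_space_scaleC)

typedef (overloaded) ('b, 'c) cblin =
  "{T :: 'b::cstar_algebra \<Rightarrow> 'c::cstar_algebra. clinear T \<and> bounded_linear T}"
  morphisms cblin_apply Cblin
  by (rule exI[of _ "\<lambda>_. 0"]) (simp add: clinear_iff bounded_linear_zero)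

setup_lifting type_definition_cblin

instantiation cblin :: (cstar_algebra, cstar_algebra) complex_vector
begin

lift_definition zero_cblin :: "('a, 'b) cblin" is "\<lambda>_. 0"
  by (simp add: clinear_iff bounded_linear_zero)

lift_definition plus_cblin :: "('a, 'b) cblin \<Rightarrow> ('a, 'b) cblin \<Rightarrow> ('a, 'b) cblin"
  is "\<lambda>S T x. S x + T x"
  by (simp add: clinear_iff bounded_linear_add scaleC_add_right algebra_simps)

lift_definition minus_cblin :: "('a, 'b) cblin \<Rightarrow> ('a, 'b) cblin \<Rightarrow> ('a, 'b) cblin"
  is "\<lambda>S T x. S x - T x"
proof (intro conjI; elim conjE)
  fix S T :: "'a \<Rightarrow> 'b"
  assume "clinear S" "clinear T"
  moreover have "z *\<^sub>C (x - y) = z *\<^sub>C x - z *\<^sub>C y" for z and x y :: 'b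
    using scaleC_add_right[of z "x - y" y] by simp
  ultimately show "clinear (\<lambda>x. S x - T x)"
    by (simp add: clinear_iff)
qed (rule bounded_linear_sub)

lift_definition uminus_cblin :: "('a, 'b) cblin \<Rightarrow> ('a, 'b) cblin" is "\<lambda>T x. - T x"
proof (intro conjI; elim conjE)
  fix T :: "'a \<Rightarrow> 'b"
  assume "clinear T"
  moreover have "z *\<^sub>C (- x) = - (z *\<^sub>C x)" for z and x :: 'b
    using scaleC_add_right[of z "- x" x] by (simp add: eq_neg_iff_add_eq_0)
  ultimately show "clinear (\<lambda>x. - T x)"
    by (simp add: clinear_iff)
qed (rule bounded_linear_minus)

lift_definition scaleC_cblin :: "complex \<Rightarrow> ('a, 'b) cblin \<Rightarrow> ('a, 'b) cblin"
  is "\<lambda>z T x. z *\<^sub>C T x"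
proof (intro conjI; elim conjE)
  fix z and T :: "'a \<Rightarrow> 'b"
  assume "clinear T" and T: "bounded_linear T"
  then show "clinear (\<lambda>x. z *\<^sub>C T x)"
    by (simp add: clinear_iff scaleC_add_right scaleC_scaleC mult.commute)
  have "bounded_linear (\<lambda>y :: 'b. z *\<^sub>C y)"
    by (rule bounded_linear_intro[where K = "cmod z"])
      (simp_all add: scaleC_add_right scaleR_scaleC scaleC_scaleC norm_scaleC mult.commute)
  then show "bounded_linear (\<lambda>x. z *\<^sub>C T x)"
    using T by (rule bounded_linear_compose)
qed

instance
  by standard (transfer; simp add: algebra_simps scaleC_add_right scaleC_add_left scaleC_scaleC
      scaleC_one)+

end

text \<open>When \<open>'b\<close> is finite-dimensional, every linear map on it is bounded, so that \<open>Cblin\<close> is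
  applied to a member of the representing set here.\<close>

definition theta :: "('b::cstar_algebra \<Rightarrow> complex) \<Rightarrow> 'b \<Rightarrow> 'c::cstar_algebra \<Rightarrow> ('b, 'c) cblin"
  where "theta \<psi> a c = Cblin (\<lambda>b. \<psi> (a * b) *\<^sub>C c)"

end

theory Submission
  imports Defs "HOL-Analysis.Operator_Norm" "HOL-Computational_Algebra.Fundamental_Theorem_Algebra"
begin

text \<open>With matrix units \<open>e\<^sub>i\<^sub>j\<close> of the blocks and \<open>q = Q\<^bsup>-1/2\<^esup>\<close> one finds
  \<open>\<Psi>' T = \<Sum> T e\<^sub>i\<^sub>j \<otimes> q e\<^sub>j\<^sub>i q\<close>, a Choi matrix. If \<open>T\<close> is completely positive, each block
  \<open>(T e\<^sub>i\<^sub>j)\<^sub>i\<^sub>j\<close> is some \<open>Y\<^sup>* Y\<close>, and \<open>\<Psi>' T = x\<^sup>* x\<close> for \<open>x = \<Sum> Y\<^sub>l\<^sub>j \<otimes> q e\<^sub>j\<^sub>l\<close>.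
  Conversely every \<open>x\<close> has this form, and \<open>T e\<^sub>i\<^sub>j = \<Sum>\<^sub>l Y\<^sub>l\<^sub>i\<^sup>* Y\<^sub>l\<^sub>j\<close> makes \<open>T (X\<^sup>* X)\<close> a sum of
  squares in \<open>M\<^sub>n(C)\<close>. The analytic point is that such a sum is a single square \<open>Z\<^sup>* Z\<close> with
  \<open>Z \<in> M\<^sub>n(C)\<close>. The square root is obtained from the binomial series of \<open>\<surd>(1 - x)\<close>, whose
  coefficients are absolutely summable, evaluated at a contraction of the Hilbert module \<open>C\<^sup>n\<close>
  (after adjoining a unit to \<open>C\<close>). That it is a contraction is seen in the order of \<open>C\<close>, so
  no norm on \<open>M\<^sub>n(C)\<close> is needed.\<close>

section \<open>The binomial series of the square root\<close>

text \<open>The exponent -1/2 and the flipped indices come from one computation: psi (a e_ij) is the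
  (j, i) entry of Qa, so the Choi sum of theta is c tensored with q (Qa) q, and q Q a q = Q^(1/2) a
  Q^(-1/2) is the modular image. The flip also suits the reversed product, which turns the factors
  e_li q and q e_jl into q e_ji q. Two obstacles account for most of the length. Positivity is
  algebraic, the existence of a square root, so the order of C rests on the theorem that sums of
  squares are squares; it is derived from the C*-identity through a norm description of the positive
  cone. And Q^w is built on a logarithm given by a definite description, which says nothing until a
  self-adjoint h with exp h = Q is known to exist and to be unique; the finite-dimensional spectral
  theory of B serves this purpose alone.\<close>

definition sqrt_coeff :: "nat \<Rightarrow> real"
  where "sqrt_coeff k = (- 1) ^ k * ((1 / 2) gchoose k)"

lemma sqrt_coeff_0 [simp]: "sqrt_coeff 0 = 1"
  by (simp add: sqrt_coeff_def)

lemma sqrt_coeff_Suc: "real (Suc k) * sqrt_coeff (Suc k) = (real k - 1 / 2) * sqrt_coeff k"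
proof -
  have "real (Suc k) * ((1 / 2 :: real) gchoose Suc k) = (1 / 2 - real k) * ((1 / 2) gchoose k)"
    using gbinomial_mult_1[of "1 / 2 :: real" k] by (simp add: algebra_simps)
  then have "(- 1) ^ Suc k * (real (Suc k) * ((1 / 2 :: real) gchoose Suc k))
      = (- 1) ^ Suc k * ((1 / 2 - real k) * ((1 / 2) gchoose k))"
    by (rule arg_cong)
  then show ?thesis
    unfolding sqrt_coeff_def by (simp add: algebra_simps)
qed

lemma sqrt_coeff_nonpos: "sqrt_coeff (Suc k) \<le> 0"
proof (induction k)
  case 0
  show ?case using sqrt_coeff_Suc[of 0] by simp
next
  case (Suc k)
  have "real (Suc (Suc k)) * sqrt_coeff (Suc (Suc k)) \<le> 0"
    unfolding sqrt_coeff_Suc[of "Suc k"] using Suc by (intro mult_nonneg_nonpos) auto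
  then show ?case by (simp add: mult_le_0_iff)
qed

text \<open>All coefficients but the first are nonpositive, so the closed form makes every partial
  sum nonnegative. This is what bounds the sum of their absolute values by the leading 1.\<close>

lemma sum_sqrt_coeff: "(\<Sum>i\<le>m. sqrt_coeff i) = - 2 * real (Suc m) * sqrt_coeff (Suc m)"
proof (induction m)
  case 0
  show ?case using sqrt_coeff_Suc[of 0] by simp
next
  case (Suc m)
  then show ?case using sqrt_coeff_Suc[of "Suc m"] by (simp add: algebra_simps)
qed

lemma sum_abs_sqrt_coeff: "(\<Sum>i<m. \<bar>sqrt_coeff (Suc i)\<bar>) \<le> 1"
proof -
  have "(\<Sum>i<m. \<bar>sqrt_coeff (Suc i)\<bar>) = 1 - (\<Sum>i\<le>m. sqrt_coeff i)"
    by (simp add: sum.atMost_shift abs_of_nonpos sqrt_coeff_nonpos sum_negf)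
  moreover have "0 \<le> (\<Sum>i\<le>m. sqrt_coeff i)"
    unfolding sum_sqrt_coeff using sqrt_coeff_nonpos[of m] by (intro mult_nonpos_nonpos) auto
  ultimately show ?thesis by simp
qed

lemma summable_abs_sqrt_coeff: "summable (\<lambda>k. \<bar>sqrt_coeff k\<bar>)"
  and suminf_abs_sqrt_coeff: "(\<Sum>k. \<bar>sqrt_coeff (Suc k)\<bar>) \<le> 1"
proof -
  have s: "summable (\<lambda>k. \<bar>sqrt_coeff (Suc k)\<bar>)"
    by (rule summableI_nonneg_bounded[OF _ sum_abs_sqrt_coeff]) simp
  then show "summable (\<lambda>k. \<bar>sqrt_coeff k\<bar>)"
    by (simp add: summable_Suc_iff[of "\<lambda>k. \<bar>sqrt_coeff k\<bar>"])
  show "(\<Sum>k. \<bar>sqrt_coeff (Suc k)\<bar>) \<le> 1"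
    by (rule suminf_le_const[OF s sum_abs_sqrt_coeff])
qed

text \<open>For the square f of the series, the recursion becomes (1 - x) f' = - f, that is (m + 1)
  u (m + 1) = (m - 1) u m. The factor m - 1 vanishes at m = 1 and ends the sequence after 1 - x.
  Symmetrising i against m - i moves the weight m onto one factor.\<close>

lemma sqrt_coeff_convolution:
  "(\<Sum>i\<le>m. sqrt_coeff i * sqrt_coeff (m - i)) = (if m = 0 then 1 else if m = 1 then - 1 else 0)"
proof -
  define s where "s = sqrt_coeff"
  define u where "u m = (\<Sum>i\<le>m. s i * s (m - i))" for m
  have sym: "(\<Sum>i\<le>m. f (m - i) * s i * s (m - i)) = (\<Sum>i\<le>m. f i * s i * s (m - i))"
    for f :: "nat \<Rightarrow> real" and m
    by (rule sum.reindex_bij_witness[of _ "\<lambda>i. m - i" "\<lambda>i. m - i"]) auto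
  have half: "real m * u m = 2 * (\<Sum>i\<le>m. real i * s i * s (m - i))" for m
  proof -
    have "real m * u m = (\<Sum>i\<le>m. real i * s i * s (m - i) + real (m - i) * s i * s (m - i))"
      unfolding u_def sum_distrib_left by (rule sum.cong) (auto simp: of_nat_diff algebra_simps)
    also have "\<dots> = 2 * (\<Sum>i\<le>m. real i * s i * s (m - i))"
      using sym[of real m] by (simp add: sum.distrib)
    finally show ?thesis .
  qed
  have rec: "real (Suc m) * u (Suc m) = (real m - 1) * u m" for m
  proof -
    have "real (Suc m) * u (Suc m) = 2 * (\<Sum>i\<le>m. real (Suc i) * s (Suc i) * s (m - i))"
      unfolding half[of "Suc m"] by (simp only: sum.atMost_Suc_shift) simp
    also have "\<dots> = 2 * (\<Sum>i\<le>m. (real i - 1 / 2) * s i * s (m - i))"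
      unfolding s_def sqrt_coeff_Suc ..
    also have "\<dots> = (real m - 1) * u m"
      using half[of m] by (simp add: algebra_simps sum_subtractf sum_distrib_left u_def sum.distrib sum_divide_distrib)
    finally show ?thesis .
  qed
  have "u 0 = 1"
    by (simp add: u_def s_def)
  moreover have "u 1 = - 1"
    using rec[of 0] \<open>u 0 = 1\<close> by simp
  moreover have "u (Suc (Suc k)) = 0" for k
  proof (induction k)
    case 0
    show ?case using rec[of 1] by simp
  next
    case (Suc k)
    then show ?case using rec[of "Suc (Suc k)"] by simp
  qed
  ultimately have "u m = (if m = 0 then 1 else if m = 1 then - 1 else 0)"
    by (cases m; cases "m - 1") auto
  then show ?thesis by (simp add: u_def s_def)
qed

definition sqrt_ser :: "'a::{real_normed_algebra_1, banach} \<Rightarrow> 'a"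
  where "sqrt_ser x = (\<Sum>k. sqrt_coeff k *\<^sub>R x ^ k)"

text \<open>Absolute summability of the coefficients admits the whole closed unit ball, so no limit
  towards norm 1 is taken. The last bound makes the root positive in the sense of
  \<open>pos\<close>, with t = 1.\<close>

lemma
  fixes x :: "'a::{real_normed_algebra_1, banach}"
  assumes x: "norm x \<le> 1"
  shows summable_sqrt_ser: "summable (\<lambda>k. norm (sqrt_coeff k *\<^sub>R x ^ k))"
    and sqrt_ser_sq: "sqrt_ser x * sqrt_ser x = 1 - x"
    and norm_one_minus_sqrt_ser: "norm (1 - sqrt_ser x) \<le> 1"
proof -
  have p: "norm (x ^ k) \<le> 1" for k
    by (rule order_trans[OF norm_power_ineq]) (simp add: power_le_one x)
  have b: "norm (sqrt_coeff k *\<^sub>R x ^ k) \<le> \<bar>sqrt_coeff k\<bar>" for k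
    using p[of k] by (simp add: mult_left_le)
  show s: "summable (\<lambda>k. norm (sqrt_coeff k *\<^sub>R x ^ k))"
    by (rule summable_comparison_test'[OF summable_abs_sqrt_coeff, of 0]) (use b in simp)
  have "(\<lambda>k. \<Sum>i\<le>k. (sqrt_coeff i *\<^sub>R x ^ i) * (sqrt_coeff (k - i) *\<^sub>R x ^ (k - i)))
      sums (sqrt_ser x * sqrt_ser x)"
    unfolding sqrt_ser_def by (rule Cauchy_product_sums[OF s s])
  moreover have "(\<Sum>i\<le>k. (sqrt_coeff i *\<^sub>R x ^ i) * (sqrt_coeff (k - i) *\<^sub>R x ^ (k - i)))
      = (if k \<in> {0, 1} then (if k = 0 then 1 else - x) else 0)" for k
  proof -
    have "(\<Sum>i\<le>k. (sqrt_coeff i *\<^sub>R x ^ i) * (sqrt_coeff (k - i) *\<^sub>R x ^ (k - i)))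
        = (\<Sum>i\<le>k. (sqrt_coeff i * sqrt_coeff (k - i)) *\<^sub>R x ^ k)"
      by (rule sum.cong) (simp_all flip: power_add)
    also have "\<dots> = (\<Sum>i\<le>k. sqrt_coeff i * sqrt_coeff (k - i)) *\<^sub>R x ^ k"
      by (simp add: scaleR_sum_left)
    finally show ?thesis by (auto simp: sqrt_coeff_convolution)
  qed
  ultimately have "(\<lambda>k. if k \<in> {0, 1} then (if k = 0 then 1 else - x) else 0) sums (sqrt_ser x * sqrt_ser x)"
    by simp
  moreover have "(\<lambda>k. if k \<in> {0, 1} then (if k = 0 then 1 else - x) else 0)
      sums (\<Sum>k\<in>{0, 1::nat}. if k = 0 then 1 else - x)"
    by (rule sums_If_finite_set) simp
  ultimately show "sqrt_ser x * sqrt_ser x = 1 - x"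
    using sums_unique2 by fastforce
  have s1: "summable (\<lambda>k. norm (sqrt_coeff (Suc k) *\<^sub>R x ^ Suc k))"
    using s by (subst summable_Suc_iff)
  have "sqrt_ser x = 1 + (\<Sum>k. sqrt_coeff (Suc k) *\<^sub>R x ^ Suc k)"
    unfolding sqrt_ser_def using suminf_split_head[OF summable_norm_cancel[OF s]] by simp
  then have "norm (1 - sqrt_ser x) = norm (\<Sum>k. sqrt_coeff (Suc k) *\<^sub>R x ^ Suc k)"
    by simp
  also have "\<dots> \<le> (\<Sum>k. norm (sqrt_coeff (Suc k) *\<^sub>R x ^ Suc k))"
    by (rule summable_norm[OF s1])
  also have "\<dots> \<le> (\<Sum>k. \<bar>sqrt_coeff (Suc k)\<bar>)"
    by (rule suminf_le[OF b s1]) (use summable_abs_sqrt_coeff summable_Suc_iff[of "\<lambda>k. \<bar>sqrt_coeff k\<bar>"] in simp)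
  also have "\<dots> \<le> 1" by (rule suminf_abs_sqrt_coeff)
  finally show "norm (1 - sqrt_ser x) \<le> 1" .
qed

lemma sqrt_ser_commute:
  fixes x y :: "'a::{real_normed_algebra_1, banach}"
  assumes "norm x \<le> 1" and "x * y = y * x"
  shows "sqrt_ser x * y = y * sqrt_ser x"
proof -
  have s: "summable (\<lambda>k. sqrt_coeff k *\<^sub>R x ^ k)"
    by (rule summable_norm_cancel[OF summable_sqrt_ser[OF assms(1)]])
  show ?thesis
    unfolding sqrt_ser_def suminf_mult2[OF s] suminf_mult[OF s, symmetric]
    by (simp add: power_commuting_commutes assms(2))
qed

section \<open>Positive elements of unital C*-algebras\<close>

lemma scaleC_minus_right: "z *\<^sub>C (- x) = - (z *\<^sub>C (x :: 'a::complex_vector))"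
  using scaleC_add_right[of z x "- x"] by (simp add: eq_neg_iff_add_eq_0 add.commute)

lemma scaleC_diff_right: "z *\<^sub>C (x - y) = z *\<^sub>C x - z *\<^sub>C (y :: 'a::complex_vector)"
  using scaleC_add_right[of z x "- y"] by (simp add: scaleC_minus_right)

lemma scaleC_zero_left [simp]: "0 *\<^sub>C x = (0 :: 'a::complex_vector)"
  using scaleC_add_left[of 0 0 x] by simp

lemma scaleC_minus_left: "(- z) *\<^sub>C x = - (z *\<^sub>C (x :: 'a::complex_vector))"
  using scaleC_add_left[of z "- z" x] by (simp add: eq_neg_iff_add_eq_0 add.commute)

lemma scaleC_diff_left: "(z - w) *\<^sub>C x = z *\<^sub>C x - w *\<^sub>C (x :: 'a::complex_vector)"
  using scaleC_add_left[of z "- w" x] by (simp add: scaleC_minus_left)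

lemma scaleC_sum_right: "z *\<^sub>C sum f A = (\<Sum>i\<in>A. z *\<^sub>C (f i :: 'a::complex_vector))"
  by (induction A rule: infinite_finite_induct) (simp_all add: scaleC_add_right)

lemma scaleC_sum_left: "sum f A *\<^sub>C x = (\<Sum>i\<in>A. f i *\<^sub>C (x :: 'a::complex_vector))"
  by (induction A rule: infinite_finite_induct) (simp_all add: scaleC_add_left)

lemma star_minus: "star (- x) = - star (x :: 'a::star_algebra)"
  using star_add[of x "- x"] by (simp add: eq_neg_iff_add_eq_0 add.commute)

lemma star_diff: "star (x - y) = star x - star (y :: 'a::star_algebra)"
  using star_add[of x "- y"] by (simp add: star_minus)

lemma star_sum: "star (sum f A) = (\<Sum>i\<in>A. star (f i :: 'a::star_algebra))"
  by (induction A rule: infinite_finite_induct) (simp_all add: star_add)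

lemma star_scaleR: "star (r *\<^sub>R x) = r *\<^sub>R star (x :: 'a::cstar_algebra)"
  by (simp add: scaleR_scaleC star_scaleC)

lemma star_one [simp]: "star (1 :: 'a::{star_algebra, ring_1}) = 1"
  by (metis mult.left_neutral mult.right_neutral star_mult star_star)

lemma star_power: "star (x ^ n) = star (x :: 'a::{star_algebra, ring_1}) ^ n"
  by (induction n) (simp_all add: star_mult power_commutes)

lemma norm_star [simp]: "norm (star x) = norm (x :: 'a::cstar_algebra)"
proof -
  have *: "norm y \<le> norm (star y)" for y :: 'a
  proof -
    have "norm y * norm y \<le> norm (star y) * norm y"
      using cstar_identity[of y] norm_mult_ineq[of "star y" y] by (simp add: power2_eq_square)
    then show ?thesis by (cases "norm y = 0") auto
  qed
  show ?thesis using *[of x] *[of "star x"] by simp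
qed

lemma bounded_linear_star: "bounded_linear (star :: 'a::cstar_algebra \<Rightarrow> 'a)"
  by (rule bounded_linear_intro[where K = 1]) (simp_all add: star_add star_scaleR)

lemma star_mult_eq_0_iff: "star x * x = 0 \<longleftrightarrow> (x :: 'a::cstar_algebra) = 0"
  using cstar_identity[of x] by auto

lemma selfadj_sq_eq_0: "star a = a \<Longrightarrow> a * a = 0 \<Longrightarrow> (a :: 'a::cstar_algebra) = 0"
  by (metis star_mult_eq_0_iff)

lemma star_sqrt_ser:
  fixes x :: "'a::cstar_algebra_1"
  assumes "norm x \<le> 1" and "star x = x"
  shows "star (sqrt_ser x) = sqrt_ser x"
  unfolding sqrt_ser_def
  using bounded_linear.suminf[OF bounded_linear_star summable_norm_cancel[OF summable_sqrt_ser[OF assms(1)]]]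
  by (simp add: star_scaleR star_power assms(2))

text \<open>If \<open>r\<close> and \<open>s\<close> are commuting and self-adjoint, then \<open>r + i s\<close> is unitary.\<close>

lemma norm_le_1_if_sq_sum_1:
  fixes r s :: "'a::cstar_algebra_1"
  assumes r: "star r = r" and s: "star s = s" and c: "r * s = s * r" and sum: "r * r + s * s = 1"
  shows "norm r \<le> 1"
proof -
  define u where "u = r + \<i> *\<^sub>C s"
  have su: "star u = r - \<i> *\<^sub>C s"
    by (simp add: u_def star_add star_scaleC r s scaleC_minus_left)
  have "star u * u = r * r + s * s"
    unfolding su by (simp add: u_def algebra_simps scaleC_mult_left scaleC_mult_right scaleC_scaleC c
        scaleC_minus_left scaleC_one scaleC_diff_right)
  then have "(norm u)\<^sup>2 = 1"
    using cstar_identity[of u] by (simp add: sum)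
  then have nu: "norm u = 1"
    by (simp add: power2_eq_1_iff) (smt (verit) norm_ge_zero)
  have "2 *\<^sub>R r = u + star u"
    unfolding su by (simp add: u_def scaleR_2)
  then have "2 * norm r \<le> norm u + norm (star u)"
    by (metis norm_scaleR norm_triangle_ineq abs_numeral)
  then show ?thesis by (simp add: nu)
qed

text \<open>For self-adjoint p the bound says that the spectrum lies in [0, 2t]. In terms of the
  norm, closure under sums is the triangle inequality, and 1 - p/t is ready for the root series. The
  link with squares is \<open>pos_iff\<close>.\<close>

definition pos :: "'a::cstar_algebra_1 \<Rightarrow> bool"
  where "pos p \<longleftrightarrow> star p = p \<and> (\<exists>t\<ge>0. norm (t *\<^sub>R 1 - p) \<le> t)"

lemma pos_selfadj: "pos p \<Longrightarrow> star p = p"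
  by (simp add: pos_def)

lemma pos_0 [simp]: "pos 0"
  by (auto simp: pos_def intro!: exI[of _ 0])

lemma pos_one_minus: "star a = a \<Longrightarrow> norm a \<le> t \<Longrightarrow> pos (t *\<^sub>R 1 - a)"
  unfolding pos_def
  by (intro conjI exI[of _ t]) (auto simp: star_diff star_scaleR intro: order_trans[OF norm_ge_zero])

lemma pos_add:
  assumes "pos p" "pos q" shows "pos (p + q)"
proof -
  from assms obtain s t where *: "s \<ge> 0" "norm (s *\<^sub>R 1 - p) \<le> s" "t \<ge> 0" "norm (t *\<^sub>R 1 - q) \<le> t"
    by (auto simp: pos_def)
  have "norm ((s + t) *\<^sub>R 1 - (p + q)) = norm ((s *\<^sub>R 1 - p) + (t *\<^sub>R 1 - q))"
    by (simp add: algebra_simps)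
  also have "\<dots> \<le> s + t"
    using * by (intro order_trans[OF norm_triangle_ineq]) simp
  finally show ?thesis
    using * assms unfolding pos_def by (auto simp: star_add intro!: exI[of _ "s + t"])
qed

lemma pos_scaleR:
  assumes "pos p" "0 \<le> r" shows "pos (r *\<^sub>R p)"
proof -
  from assms obtain t where *: "t \<ge> 0" "norm (t *\<^sub>R 1 - p) \<le> t"
    by (auto simp: pos_def)
  have "norm ((r * t) *\<^sub>R 1 - r *\<^sub>R p) = norm (r *\<^sub>R (t *\<^sub>R 1 - p))"
    by (simp add: algebra_simps)
  also have "\<dots> \<le> r * t"
    using * assms by (simp add: mult_left_mono)
  finally show ?thesis
    using * assms unfolding pos_def by (auto simp: star_scaleR intro!: exI[of _ "r * t"])
qed

text \<open>If \<open>\<parallel>a\<parallel> \<le> 1\<close>, then \<open>\<surd>(1 - a\<^sup>2) + i a\<close> is unitary.\<close>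

lemma norm_one_minus_sq:
  fixes a :: "'a::cstar_algebra_1"
  assumes a: "star a = a" and n: "norm a \<le> 1"
  shows "norm (1 - a * a) \<le> 1"
proof -
  have na: "norm (a * a) \<le> 1"
    using norm_mult_ineq[of a a] n by (smt (verit) mult_left_le norm_ge_zero)
  define r where "r = sqrt_ser (a * a)"
  have rr: "r * r = 1 - a * a"
    unfolding r_def by (rule sqrt_ser_sq[OF na])
  have "norm r \<le> 1"
  proof (rule norm_le_1_if_sq_sum_1)
    show "star r = r"
      unfolding r_def by (rule star_sqrt_ser[OF na]) (simp add: star_mult a)
    show "star a = a" by (rule a)
    show "r * a = a * r"
      unfolding r_def by (rule sqrt_ser_commute[OF na]) (simp add: mult.assoc)
    show "r * r + a * a = 1" by (simp add: rr)
  qed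
  then have "norm (r * r) \<le> 1"
    by (intro order_trans[OF norm_mult_ineq]) (simp add: mult_le_one)
  then show ?thesis by (simp add: rr)
qed

lemma pos_sq:
  fixes a :: "'a::cstar_algebra_1"
  assumes a: "star a = a" shows "pos (a * a)"
proof (cases "a = 0")
  case False
  define b where "b = inverse (norm a) *\<^sub>R a"
  have "star b = b" "norm b \<le> 1"
    using False by (simp_all add: b_def star_scaleR a)
  then have "pos (b * b)"
    unfolding pos_def using norm_one_minus_sq[of b] by (auto simp: star_mult intro!: exI[of _ 1])
  moreover have "a = norm a *\<^sub>R b"
    using False by (simp add: b_def)
  then have "a * a = (norm a * norm a) *\<^sub>R (b * b)"
    by (metis mult_scaleR_left mult_scaleR_right scaleR_scaleR)
  ultimately show ?thesis by (metis pos_scaleR zero_le_mult_iff norm_ge_zero)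
qed simp

text \<open>Rescaling by t brings 1 - p/t into the unit ball, where the root series applies. The
  commutation clause stands in for functional calculus: roots of commuting elements commute.\<close>

lemma pos_sqrt:
  fixes p :: "'a::cstar_algebra_1"
  assumes "pos p"
  shows "\<exists>r. pos r \<and> r * r = p \<and> (\<forall>y. p * y = y * p \<longrightarrow> r * y = y * r)"
proof -
  from assms obtain t where t: "t \<ge> 0" "norm (t *\<^sub>R 1 - p) \<le> t" and p: "star p = p"
    by (auto simp: pos_def)
  show ?thesis
  proof (cases "t = 0")
    case True
    then have "p = 0" using t by simp
    then show ?thesis by (auto intro!: exI[of _ 0])
  next
    case False
    define x where "x = 1 - inverse t *\<^sub>R p"
    have "x = inverse t *\<^sub>R (t *\<^sub>R 1 - p)"
      using False by (simp add: x_def algebra_simps)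
    then have "norm x = inverse t * norm (t *\<^sub>R 1 - p)"
      using t by simp
    also have "\<dots> \<le> inverse t * t"
      using t by (intro mult_left_mono) auto
    finally have x: "norm x \<le> 1"
      using False by simp
    have sx: "star x = x"
      by (simp add: x_def star_diff star_scaleR p)
    define r where "r = sqrt t *\<^sub>R sqrt_ser x"
    have "pos (sqrt_ser x)"
      unfolding pos_def using norm_one_minus_sqrt_ser[OF x] star_sqrt_ser[OF x sx]
      by (auto intro!: exI[of _ 1])
    then have "pos r"
      unfolding r_def using t by (intro pos_scaleR) auto
    moreover have "r * r = p"
      using t False by (simp add: r_def sqrt_ser_sq[OF x]) (simp add: x_def)
    moreover have "r * y = y * r" if "p * y = y * p" for y
    proof -
      have "x * y = y * x"
        by (simp add: x_def algebra_simps that)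
      then show ?thesis
        unfolding r_def using sqrt_ser_commute[OF x] by simp
    qed
    ultimately show ?thesis by blast
  qed
qed

lemma pos_mult:
  assumes "pos p" "pos q" "p * q = q * (p :: 'a::cstar_algebra_1)"
  shows "pos (p * q)"
proof -
  obtain r where r: "pos r" "r * r = p" "\<And>y. p * y = y * p \<Longrightarrow> r * y = y * r"
    using pos_sqrt[OF assms(1)] by blast
  obtain s where s: "pos s" "s * s = q" "\<And>y. q * y = y * q \<Longrightarrow> s * y = y * s"
    using pos_sqrt[OF assms(2)] by blast
  have "s * r = r * s"
    using r(3)[of q] s(3)[of r] assms(3) by simp
  have "(r * s) * (r * s) = r * (s * r) * s"
    by (simp only: mult.assoc)
  also have "\<dots> = (r * r) * (s * s)"
    unfolding \<open>s * r = r * s\<close> by (simp only: mult.assoc)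
  also have "\<dots> = p * q"
    by (simp only: r(2) s(2))
  finally have "p * q = (r * s) * (r * s)" ..
  moreover have "star (r * s) = r * s"
    by (simp add: star_mult pos_selfadj r(1) s(1) \<open>s * r = r * s\<close>)
  ultimately show ?thesis using pos_sq by metis
qed

text \<open>After scaling to t = 1, both p and 1 - p have roots r and s that commute and satisfy r^2
  + s^2 = 1, so r is the real part of a unitary.\<close>

lemma pos_le_imp_norm_le:
  fixes p :: "'a::cstar_algebra_1"
  assumes p: "pos p" and q: "pos (t *\<^sub>R 1 - p)" and t: "t \<ge> 0"
  shows "norm p \<le> t"
proof -
  have *: "norm p \<le> t" if p: "pos p" and q: "pos (t *\<^sub>R 1 - p)" and t: "t > 0" for t and p :: 'a
  proof -
    define a where "a = inverse t *\<^sub>R p"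
    have a: "pos a"
      unfolding a_def using p t by (intro pos_scaleR) auto
    have "1 - a = inverse t *\<^sub>R (t *\<^sub>R 1 - p)"
      using t by (simp add: a_def algebra_simps)
    then have "pos (1 - a)"
      using q t by (simp add: pos_scaleR)
    then obtain s where s: "pos s" "s * s = 1 - a" "\<And>y. (1 - a) * y = y * (1 - a) \<Longrightarrow> s * y = y * s"
      using pos_sqrt by blast
    obtain r where r: "pos r" "r * r = a" "\<And>y. a * y = y * a \<Longrightarrow> r * y = y * r"
      using pos_sqrt[OF a] by blast
    have "s * a = a * s"
      by (rule s(3)) (simp add: algebra_simps)
    then have "r * s = s * r"
      using r(3)[of s] by simp
    then have "norm r \<le> 1"
      by (rule norm_le_1_if_sq_sum_1[OF pos_selfadj[OF r(1)] pos_selfadj[OF s(1)]])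
        (simp add: r(2) s(2))
    then have "norm a \<le> 1"
      unfolding r(2)[symmetric] by (intro order_trans[OF norm_mult_ineq]) (simp add: mult_le_one)
    then show ?thesis
      using t by (simp add: a_def field_simps)
  qed
  \<comment> \<open>The scaling divides by t, so t = 0 is reached as a limit of positive
    bounds.\<close>
  have "norm p \<le> t + e" if "e > 0" for e
  proof (rule *[OF p])
    have "(t + e) *\<^sub>R 1 - p = (t *\<^sub>R 1 - p) + (e *\<^sub>R 1 - 0)"
      by (simp add: algebra_simps)
    also have "pos \<dots>"
      using that by (intro pos_add q pos_one_minus) auto
    finally show "pos ((t + e) *\<^sub>R 1 - p)" .
  qed (use t that in simp)
  then show ?thesis by (rule field_le_epsilon)
qed

lemma pos_norm_mono:
  assumes "pos p" "pos (q - p)" shows "norm p \<le> norm (q :: 'a::cstar_algebra_1)"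
proof (rule pos_le_imp_norm_le[OF assms(1)])
  have q: "pos q"
    using pos_add[OF assms] by simp
  have "norm q *\<^sub>R 1 - p = (norm q *\<^sub>R 1 - q) + (q - p)"
    by simp
  also have "pos \<dots>"
    using q by (intro pos_add assms(2) pos_one_minus) (auto simp: pos_selfadj)
  finally show "pos (norm q *\<^sub>R 1 - p)" .
qed simp

lemma pos_antisym: "pos p \<Longrightarrow> pos (- p) \<Longrightarrow> (p :: 'a::cstar_algebra_1) = 0"
  using pos_norm_mono[of p 0] by simp

text \<open>Bernoulli's inequality in the order of the algebra: passing from k to k + 1 adds p ((1 +
  p)^k - 1), a product of commuting positive elements. The commutation is carried along for
  \<open>pos_mult\<close>. The linear growth in k is played off against a bound in
  \<open>neg_square_eq_0_aux\<close>.\<close>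

lemma pos_power_minus:
  fixes p :: "'a::cstar_algebra_1"
  assumes p: "pos p"
  shows "pos ((1 + p) ^ k - 1 - real k *\<^sub>R p) \<and> (1 + p) ^ k * p = p * (1 + p) ^ k"
proof (induction k)
  case (Suc k)
  have c: "(1 + p) ^ k * p = p * (1 + p) ^ k" using Suc by simp
  have "(1 + p) ^ k - 1 = ((1 + p) ^ k - 1 - real k *\<^sub>R p) + real k *\<^sub>R p"
    by simp
  also have "pos \<dots>"
    using Suc p by (intro pos_add pos_scaleR) auto
  finally have q: "pos ((1 + p) ^ k - 1)" .
  have "pos (p * ((1 + p) ^ k - 1))"
    using p q by (rule pos_mult) (simp add: algebra_simps c)
  moreover have "(1 + p) ^ Suc k - 1 - real (Suc k) *\<^sub>R p
      = ((1 + p) ^ k - 1 - real k *\<^sub>R p) + p * ((1 + p) ^ k - 1)"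
    by (simp add: algebra_simps)
  ultimately have "pos ((1 + p) ^ Suc k - 1 - real (Suc k) *\<^sub>R p)"
    using Suc pos_add by metis
  then show ?case
    by (simp add: algebra_simps c)
qed simp

text \<open>Since \<open>y p = - (y y\<^sup>*) y\<close>, the elements \<open>y (1 + p)\<^sup>k = (1 - y y\<^sup>*)\<^sup>k y\<close> stay bounded if
  \<open>y y\<^sup>*\<close> is positive of norm at most \<open>1\<close>, whereas \<open>y\<^sup>* y (1 + p)\<^sup>k\<close> dominates \<open>k p\<^sup>2\<close> in norm.\<close>

lemma neg_square_eq_0_aux:
  fixes y :: "'a::cstar_algebra_1"
  assumes p: "pos (- (star y * y))" and y: "norm (y * star y) \<le> 1"
  shows "y = 0"
proof -
  define p where "p = - (star y * y)"
  \<comment> \<open>With h and k the real and imaginary parts of y,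
    \<open>star y * y + y * star y\<close> is 2 (h^2 + k^2). Hence q is this plus p, a sum of
    positive elements.\<close>
  define h where "h = (1 / 2) *\<^sub>R (y + star y)"
  define k where "k = (1 / 2) *\<^sub>R (\<i> *\<^sub>C (star y - y))"
  define q where "q = y * star y"
  have hs: "star h = h" and ks: "star k = k"
    by (simp_all add: h_def k_def star_scaleR star_scaleC star_add star_diff scaleC_minus_left
        scaleC_diff_right add.commute)
  have "(\<i> *\<^sub>C d) * (\<i> *\<^sub>C d) = - (d * d)" for d :: 'a
    by (simp add: scaleC_mult_left scaleC_mult_right scaleC_scaleC scaleC_minus_left scaleC_one)
  then have "4 *\<^sub>R (h * h + k * k) = (y + star y) * (y + star y) - (star y - y) * (star y - y)"
    unfolding h_def k_def by (simp del: scaleR_add_right add: scaleR_diff_right[of 4])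
  also have "\<dots> = 2 *\<^sub>R (q - p)"
    by (simp add: p_def q_def algebra_simps scaleR_2)
  finally have "2 *\<^sub>R (2 *\<^sub>R (h * h + k * k)) = 2 *\<^sub>R (q - p)"
    by simp
  then have "2 *\<^sub>R (h * h + k * k) = q - p"
    unfolding scaleR_cancel_left by simp
  then have "q = 2 *\<^sub>R (h * h + k * k) + p"
    by simp
  moreover have "pos p"
    using p by (simp add: p_def)
  ultimately have q: "pos q"
    by (simp add: pos_add pos_scaleR pos_sq hs ks del: scaleR_add_right)
  have q1: "norm (1 - q) \<le> 1"
  proof (rule pos_le_imp_norm_le)
    show "pos (1 - q)"
      using pos_one_minus[of q 1] y q by (simp add: q_def pos_selfadj)
  qed (simp_all add: q)
  have yp: "y * (1 + p) = (1 - q) * y"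
    by (simp add: p_def q_def algebra_simps)
  have "y * (1 + p) ^ n = (1 - q) ^ n * y" for n
  proof (induction n)
    case (Suc n)
    have "y * (1 + p) ^ Suc n = (1 - q) * (y * (1 + p) ^ n)"
      by (simp add: yp flip: mult.assoc)
    then show ?case by (simp add: Suc mult.assoc)
  qed simp
  then have "p * (1 + p) ^ n = - (star y * (1 - q) ^ n * y)" for n
    by (simp add: p_def mult.assoc)
  moreover have "norm (star y * (1 - q) ^ n * y) \<le> norm y * 1 * norm y" for n
  proof -
    have "norm ((1 - q) ^ n) \<le> 1"
      by (rule order_trans[OF norm_power_ineq]) (simp add: power_le_one q1)
    then show ?thesis
      by (intro norm_mult_ineq[THEN order_trans] mult_mono) auto
  qed
  ultimately have bd: "norm (p * (1 + p) ^ n) \<le> norm y * norm y" for n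
    by (simp del: norm_mult)
  have pp: "pos p" using p by (simp add: p_def)
  have lower: "real n * norm (p * p) \<le> norm y * norm y" for n
  proof -
    have e: "pos ((1 + p) ^ n - 1 - real n *\<^sub>R p)" and c: "(1 + p) ^ n * p = p * (1 + p) ^ n"
      using pos_power_minus[OF pp] by auto
    have "pos (p * ((1 + p) ^ n - 1 - real n *\<^sub>R p))"
      by (rule pos_mult[OF pp e]) (simp add: algebra_simps c)
    \<comment> \<open>The added p cancels the term - p that the 1 inside the bracket
      contributes.\<close>
    then have "pos (p * ((1 + p) ^ n - 1 - real n *\<^sub>R p) + p)"
      using pp by (rule pos_add)
    then have "pos (p * (1 + p) ^ n - real n *\<^sub>R (p * p))"
      by (simp add: algebra_simps)
    then have "norm (real n *\<^sub>R (p * p)) \<le> norm (p * (1 + p) ^ n)"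
      by (intro pos_norm_mono pos_scaleR pos_mult pp) auto
    then show ?thesis using bd[of n] by simp
  qed
  have "norm (p * p) = 0"
  proof (rule ccontr)
    assume "norm (p * p) \<noteq> 0"
    then have "norm (p * p) > 0" by simp
    then obtain n where "norm y * norm y < real n * norm (p * p)"
      using reals_Archimedean3 by blast
    then show False using lower[of n] by simp
  qed
  then have "p = 0"
    using selfadj_sq_eq_0[OF pos_selfadj[OF pp]] by simp
  then show ?thesis
    by (simp add: p_def star_mult_eq_0_iff)
qed

lemma neg_square_eq_0:
  fixes y :: "'a::cstar_algebra_1"
  assumes p: "pos (- (star y * y))"
  shows "y = 0"
proof (rule ccontr)
  assume "y \<noteq> 0"
  define z where "z = inverse (norm y) *\<^sub>R y"
  have "- (star z * z) = (inverse (norm y) * inverse (norm y)) *\<^sub>R (- (star y * y))"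
    by (simp add: z_def star_scaleR)
  then have "pos (- (star z * z))"
    using p by (metis pos_scaleR zero_le_mult_iff norm_ge_zero inverse_nonnegative_iff_nonnegative)
  moreover have "norm z = 1"
    using \<open>y \<noteq> 0\<close> by (simp add: z_def)
  then have "norm (z * star z) \<le> 1"
    using norm_mult_ineq[of z "star z"] by simp
  ultimately have "z = 0" by (rule neg_square_eq_0_aux)
  then show False using \<open>norm z = 1\<close> by simp
qed

text \<open>With \<open>a = x\<^sup>* x\<close> and \<open>b = (|a| - a) / 2\<close> its negative part, \<open>y = x b\<close> has
  \<open>- y\<^sup>* y = b\<^sup>3\<close> positive.\<close>

theorem pos_star_mult:
  fixes x :: "'a::cstar_algebra_1"
  shows "pos (star x * x)"
proof -
  define a where "a = star x * x"
  have a: "star a = a" by (simp add: a_def star_mult)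
  obtain r where r: "pos r" "r * r = a * a" "\<And>y. (a * a) * y = y * (a * a) \<Longrightarrow> r * y = y * r"
    using pos_sqrt[OF pos_sq[OF a]] by blast
  \<comment> \<open>Here r is the absolute value of a. Its root s commutes with b, so that b r b is
    the square of the self-adjoint element s b.\<close>
  obtain s where s: "pos s" "s * s = r" "\<And>y. r * y = y * r \<Longrightarrow> s * y = y * s"
    using pos_sqrt[OF r(1)] by blast
  have ra: "r * a = a * r" by (rule r(3)) (simp add: mult.assoc)
  define b where "b = (1 / 2) *\<^sub>R (r - a)"
  have b: "star b = b" by (simp add: b_def star_scaleR star_diff a pos_selfadj[OF r(1)])
  have rb: "r * b = b * r" by (simp add: b_def algebra_simps ra)
  have sb: "s * b = b * s" by (rule s(3)[OF rb])
  have bb: "b * b = r * b"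
  proof -
    have "4 *\<^sub>R (b * b) = (r - a) * (r - a)"
      by (simp add: b_def)
    also have "\<dots> = 2 *\<^sub>R (r * (r - a))"
      by (simp add: algebra_simps r(2) ra scaleR_2)
    also have "\<dots> = 4 *\<^sub>R (r * b)"
      by (simp add: b_def)
    finally show ?thesis by simp
  qed
  have ab: "a * b = - (b * b)"
  proof -
    have "a = r - 2 *\<^sub>R b" by (simp add: b_def)
    then have "a * b = (r - 2 *\<^sub>R b) * b" by (rule arg_cong)
    then have "a * b = r * b - 2 *\<^sub>R (b * b)" by (simp add: left_diff_distrib)
    then show ?thesis by (simp add: bb scaleR_2)
  qed
  define y where "y = x * b"
  have "star y * y = b * (a * b)"
    by (simp add: y_def star_mult b a_def mult.assoc)
  also have "\<dots> = - (b * (r * b))" by (simp add: ab bb)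
  also have "b * (r * b) = (s * b) * (s * b)"
    by (metis s(2) sb mult.assoc)
  finally have "- (star y * y) = (s * b) * (s * b)" by simp
  moreover have "star (s * b) = s * b"
    by (simp add: star_mult b sb pos_selfadj[OF s(1)])
  ultimately have "pos (- (star y * y))"
    using pos_sq by metis
  then have "y = 0" by (rule neg_square_eq_0)
  then have "b * (a * b) = 0"
    using \<open>star y * y = b * (a * b)\<close> by simp
  then have "(b * b) * b = 0" by (simp add: ab mult.assoc)
  then have "(b * b) * (b * b) = 0"
    unfolding mult.assoc[symmetric, of "b * b"] by simp
  then have "b * b = 0"
    by (rule selfadj_sq_eq_0[rotated]) (simp add: star_mult b)
  then have "b = 0" by (rule selfadj_sq_eq_0[OF b])
  then have "a = r" by (simp add: b_def)
  then show ?thesis using r(1) unfolding a_def by simp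
qed

text \<open>Squares are positive by the preceding theorem, and roots give the converse. Additivity
  is read off the left side, invariance under conjugation off the right.\<close>

lemma pos_iff: "pos p \<longleftrightarrow> (\<exists>x. p = star x * (x :: 'a::cstar_algebra_1))"
  using pos_star_mult pos_sqrt pos_selfadj by metis

text \<open>The squared norm of c minus \<open>star c * c\<close> is positive, hence some
  \<open>star x * x\<close>, and conjugating by y gives the square of x y.\<close>

lemma pos_compress:
  fixes c y :: "'a::cstar_algebra_1"
  shows "pos ((norm c)\<^sup>2 *\<^sub>R (star y * y) - star (c * y) * (c * y))"
proof -
  have "pos ((norm c)\<^sup>2 *\<^sub>R 1 - star c * c)"
    by (rule pos_one_minus) (simp_all add: star_mult cstar_identity)
  then obtain x where x: "(norm c)\<^sup>2 *\<^sub>R 1 - star c * c = star x * x"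
    by (auto simp: pos_iff)
  have "(norm c)\<^sup>2 *\<^sub>R (star y * y) - star (c * y) * (c * y)
      = star y * ((norm c)\<^sup>2 *\<^sub>R 1 - star c * c) * y"
    by (simp add: star_mult algebra_simps)
  also have "\<dots> = star (x * y) * (x * y)"
    by (simp add: x star_mult mult.assoc)
  finally show ?thesis by (simp add: pos_star_mult)
qed

section \<open>The unitization\<close>

datatype 'a unitization = Unitization (scalar_part: complex) (vector_part: 'a)

instantiation unitization :: (star_algebra) star_algebra
begin
definition "0 = Unitization 0 0"
definition "x + y = Unitization (scalar_part x + scalar_part y) (vector_part x + vector_part y)"
definition "x - y = Unitization (scalar_part x - scalar_part y) (vector_part x - vector_part y)"
definition "- x = Unitization (- scalar_part x) (- vector_part x)"
definition "z *\<^sub>C x = Unitization (z * scalar_part x) (z *\<^sub>C vector_part x)"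
definition "star x = Unitization (cnj (scalar_part x)) (star (vector_part x))"
definition "x * y = Unitization (scalar_part x * scalar_part y)
  (scalar_part x *\<^sub>C vector_part y + scalar_part y *\<^sub>C vector_part x + vector_part x * vector_part y)"
instance
  by standard
    (simp_all add: zero_unitization_def plus_unitization_def minus_unitization_def
      uminus_unitization_def scaleC_unitization_def star_unitization_def times_unitization_def
      scaleC_add_right scaleC_add_left scaleC_scaleC scaleC_one scaleC_mult_left scaleC_mult_right
      star_add star_scaleC star_mult algebra_simps)
end

instantiation unitization :: (star_algebra) ring_1
begin
definition "1 = Unitization 1 0"
instance
  by standard (simp_all add: one_unitization_def times_unitization_def scaleC_one
      zero_unitization_def unitization.expand)
end

lemma unitization_parts [simp]:
  "scalar_part 0 = 0" "vector_part 0 = 0" "scalar_part 1 = 1" "vector_part 1 = 0"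
  "scalar_part (x + y) = scalar_part x + scalar_part y" "vector_part (x + y) = vector_part x + vector_part y"
  "scalar_part (x - y) = scalar_part x - scalar_part y" "vector_part (x - y) = vector_part x - vector_part y"
  "scalar_part (z *\<^sub>C x) = z * scalar_part x" "vector_part (z *\<^sub>C x) = z *\<^sub>C vector_part x"
  "scalar_part (star x) = cnj (scalar_part x)" "vector_part (star x) = star (vector_part x)"
  "scalar_part (x * y) = scalar_part x * scalar_part y"
  "vector_part (x * y) = scalar_part x *\<^sub>C vector_part y + scalar_part y *\<^sub>C vector_part x
    + vector_part x * vector_part y"
  by (simp_all add: zero_unitization_def one_unitization_def plus_unitization_def
      minus_unitization_def scaleC_unitization_def star_unitization_def times_unitization_def)

section \<open>The action of the unitization by left multiplication, and its C*-norm\<close>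

definition left_op :: "'a::star_algebra unitization \<Rightarrow> 'a \<Rightarrow> 'a"
  where "left_op u x = scalar_part u *\<^sub>C x + vector_part u * x"

lemma left_op_algebra:
  "left_op 0 x = 0"
  "left_op 1 x = x"
  "left_op (u + v) x = left_op u x + left_op v x"
  "left_op (z *\<^sub>C u) x = z *\<^sub>C left_op u x"
  "left_op (u * v) x = left_op u (left_op v x)"
  "star (left_op u x) * y = star x * left_op (star u) y"
  by (simp_all add: left_op_def scaleC_add_left scaleC_add_right scaleC_scaleC scaleC_one star_add
      star_scaleC star_mult scaleC_mult_left scaleC_mult_right algebra_simps)

text \<open>The scalar part has to be controlled separately: if the algebra has a unit,
  \<open>Unitization (- 1) 1\<close> acts as zero. The vector part is detected by acting on its own
  adjoint, through the C*-identity.\<close>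

lemma left_op_inj:
  assumes "scalar_part u = 0" and "\<And>x. left_op u x = 0" shows "u = (0 :: 'a::cstar_algebra unitization)"
proof -
  have "star (star (vector_part u)) * star (vector_part u) = 0"
    using assms(2)[of "star (vector_part u)"] by (simp add: left_op_def assms(1))
  then have "vector_part u = 0"
    unfolding star_mult_eq_0_iff by (metis star_star star_zero)
  then show ?thesis by (simp add: assms(1) unitization.expand)
qed

lemma norm_left_op_le:
  "norm (left_op u x) \<le> (cmod (scalar_part u) + norm (vector_part u)) * norm (x :: 'a::cstar_algebra)"
  unfolding left_op_def
  by (rule order_trans[OF norm_triangle_ineq])
    (simp add: norm_scaleC norm_mult_ineq distrib_right)

lemma scaleC_scaleR_commute: "z *\<^sub>C (r *\<^sub>R x) = r *\<^sub>R (z *\<^sub>C (x :: 'a::cstar_algebra))"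
  by (simp add: scaleR_scaleC scaleC_scaleC mult.commute)

lemma bounded_linear_left_op: "bounded_linear (left_op (u :: 'a::cstar_algebra unitization))"
  by (rule bounded_linear_intro[where K = "cmod (scalar_part u) + norm (vector_part u)"])
    (use norm_left_op_le in \<open>auto simp: left_op_def scaleC_add_right algebra_simps scaleC_scaleR_commute\<close>)

lemma onorm_left_op_le:
  "onorm (left_op u) \<le> cmod (scalar_part u) + norm (vector_part (u :: 'a::cstar_algebra unitization))"
  by (rule onorm_bound) (use norm_left_op_le in auto)

lemma norm_le_onorm_left_op:
  fixes u :: "'a::cstar_algebra unitization"
  assumes "scalar_part u = 0"
  shows "norm (vector_part u) \<le> onorm (left_op u)"
proof (cases "vector_part u = 0")
  case False
  have "norm (vector_part u) * norm (vector_part u) = norm (left_op u (star (vector_part u)))"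
    using cstar_identity[of "star (vector_part u)"]
    by (simp add: left_op_def assms power2_eq_square)
  also have "\<dots> \<le> onorm (left_op u) * norm (vector_part u)"
    using onorm[OF bounded_linear_left_op, of u "star (vector_part u)"] by simp
  finally show ?thesis using False by simp
qed (simp add: onorm_pos_le[OF bounded_linear_left_op])

lemma onorm_left_op_mult: "onorm (left_op (u * v)) \<le> onorm (left_op u) * onorm (left_op v)"
  for u v :: "'a::cstar_algebra unitization"
  using onorm_compose[OF bounded_linear_left_op bounded_linear_left_op, of u v]
  by (simp add: left_op_algebra(5)[abs_def] o_def)

text \<open>The squared norm of \<open>left_op v x\<close> is the norm of
  \<open>star x * left_op (star v * v) x\<close>, so the C*-identity passes from the algebra to the
  action: first as an inequality, from which v and \<open>star v\<close> get the same norm, then as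
  an equality.\<close>

lemma onorm_left_op_star_mult:
  fixes u :: "'a::cstar_algebra unitization"
  shows "onorm (left_op (star u * u)) = (onorm (left_op u))\<^sup>2"
proof -
  have *: "(onorm (left_op v))\<^sup>2 \<le> onorm (left_op (star v * v))" for v :: "'a unitization"
  proof -
    have "norm (left_op v x) \<le> sqrt (onorm (left_op (star v * v))) * norm x" for x
    proof -
      have "(norm (left_op v x))\<^sup>2 = norm (star x * left_op (star v * v) x)"
        by (simp add: left_op_algebra flip: cstar_identity)
      also have "\<dots> \<le> norm x * (onorm (left_op (star v * v)) * norm x)"
        by (rule order_trans[OF norm_mult_ineq])
          (simp add: mult_left_mono onorm bounded_linear_left_op)
      also have "\<dots> = (sqrt (onorm (left_op (star v * v))) * norm x)\<^sup>2"
        by (simp add: power2_eq_square onorm_pos_le bounded_linear_left_op mult_ac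
            flip: real_sqrt_mult)
      finally show ?thesis
        by (rule power2_le_imp_le) (simp add: onorm_pos_le bounded_linear_left_op)
    qed
    then have "onorm (left_op v) \<le> sqrt (onorm (left_op (star v * v)))"
      by (intro onorm_bound) (simp_all add: onorm_pos_le bounded_linear_left_op)
    then have "(onorm (left_op v))\<^sup>2 \<le> (sqrt (onorm (left_op (star v * v))))\<^sup>2"
      by (rule power_mono) (simp add: onorm_pos_le bounded_linear_left_op)
    then show ?thesis by (simp add: onorm_pos_le bounded_linear_left_op)
  qed
  have **: "onorm (left_op v) \<le> onorm (left_op (star v))" for v :: "'a unitization"
  proof (cases "onorm (left_op v) = 0")
    case False
    have "onorm (left_op v) * onorm (left_op v) \<le> onorm (left_op (star v)) * onorm (left_op v)"
      using *[of v] onorm_left_op_mult[of "star v" v] by (simp add: power2_eq_square)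
    then show ?thesis
      using False onorm_pos_le[OF bounded_linear_left_op[of v]] by simp
  qed (simp add: onorm_pos_le bounded_linear_left_op)
  have "onorm (left_op (star u)) = onorm (left_op u)"
    using **[of u] **[of "star u"] by simp
  then show ?thesis
    using *[of u] onorm_left_op_mult[of "star u" u] by (simp add: power2_eq_square)
qed

text \<open>If the algebra already has a unit, the norm of left multiplication alone is degenerate;
  the maximum with the modulus of the scalar part is the C*-norm in either case.\<close>

instantiation unitization :: (cstar_algebra) real_normed_algebra_1
begin
definition "r *\<^sub>R (x :: 'a unitization) = complex_of_real r *\<^sub>C x"
definition "norm (u :: 'a unitization) = max (cmod (scalar_part u)) (onorm (left_op u))"
definition "dist x (y :: 'a unitization) = norm (x - y)"
definition "sgn (x :: 'a unitization) = inverse (norm x) *\<^sub>R x"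
definition "(uniformity :: ('a unitization \<times> 'a unitization) filter)
  = (INF e\<in>{0<..}. principal {(x, y). dist x y < e})"
definition "open (U :: 'a unitization set) = (\<forall>x\<in>U. eventually (\<lambda>(x', y). x' = x \<longrightarrow> y \<in> U) uniformity)"
instance
proof
  fix x y :: "'a unitization" and a b :: real and U :: "'a unitization set"
  show "a *\<^sub>R (x + y) = a *\<^sub>R x + a *\<^sub>R y" "(a + b) *\<^sub>R x = a *\<^sub>R x + b *\<^sub>R x"
    "a *\<^sub>R b *\<^sub>R x = (a * b) *\<^sub>R x" "1 *\<^sub>R x = x"
    "a *\<^sub>R x * y = a *\<^sub>R (x * y)" "x * a *\<^sub>R y = a *\<^sub>R (x * y)"
    by (simp_all add: scaleR_unitization_def scaleC_add_right scaleC_add_left scaleC_scaleC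
        scaleC_one scaleC_mult_left scaleC_mult_right)
  show "dist x y = norm (x - y)" "sgn x = inverse (norm x) *\<^sub>R x"
    "uniformity = (INF e\<in>{0<..}. principal {(x, y). dist (x::'a unitization) y < e})"
    "open U = (\<forall>x\<in>U. eventually (\<lambda>(x', y). x' = x \<longrightarrow> y \<in> U) uniformity)"
    by (simp_all add: dist_unitization_def sgn_unitization_def uniformity_unitization_def
        open_unitization_def)
  have "x = 0" if "norm x = 0"
  proof (rule left_op_inj)
    have "onorm (left_op x) = 0" "scalar_part x = 0"
      using that onorm_pos_le[OF bounded_linear_left_op[of x]]
      by (auto simp: norm_unitization_def max_def split: if_splits)
    then show "scalar_part x = 0" "left_op x v = 0" for v
      using onorm_eq_0[OF bounded_linear_left_op[of x]] by auto
  qed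
  moreover have "norm (0 :: 'a unitization) = 0"
    by (simp add: norm_unitization_def left_op_algebra(1)[abs_def] onorm_zero)
  ultimately show "norm x = 0 \<longleftrightarrow> x = 0" by auto
  have "onorm (left_op (x + y)) \<le> onorm (left_op x) + onorm (left_op y)"
    unfolding left_op_algebra(3)[abs_def]
    by (rule onorm_triangle[OF bounded_linear_left_op bounded_linear_left_op])
  then show "norm (x + y) \<le> norm x + norm y"
    unfolding norm_unitization_def using norm_triangle_ineq[of "scalar_part x" "scalar_part y"]
    by auto
  have "left_op (a *\<^sub>R x) = (\<lambda>v. a *\<^sub>R left_op x v)"
    by (rule ext) (simp add: scaleR_unitization_def left_op_algebra scaleR_scaleC)
  then have "onorm (left_op (a *\<^sub>R x)) = \<bar>a\<bar> * onorm (left_op x)"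
    by (simp add: onorm_scaleR bounded_linear_left_op)
  then show "norm (a *\<^sub>R x) = \<bar>a\<bar> * norm x"
    by (simp add: norm_unitization_def scaleR_unitization_def norm_mult max_mult_distrib_left)
  show "norm (x * y) \<le> norm x * norm y"
  proof -
    have "onorm (left_op (x * y)) \<le> norm x * norm y"
      by (rule order_trans[OF onorm_left_op_mult], rule mult_mono)
        (auto simp: norm_unitization_def onorm_pos_le bounded_linear_left_op intro: le_max_iff_disj[THEN iffD2])
    moreover have "cmod (scalar_part x * scalar_part y) \<le> norm x * norm y"
      unfolding norm_mult by (rule mult_mono) (auto simp: norm_unitization_def intro: le_max_iff_disj[THEN iffD2])
    ultimately show ?thesis
      by (simp add: norm_unitization_def[of "x * y"])
  qed
  have "left_op (1 :: 'a unitization) = (\<lambda>x. x)"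
    by (rule ext) (simp add: left_op_algebra)
  then show "norm (1 :: 'a unitization) = 1"
    using onorm_id_le[where 'a = 'a] by (simp add: norm_unitization_def)
qed
end

lemma norm_scalar_part_le: "cmod (scalar_part u) \<le> norm (u :: 'a::cstar_algebra unitization)"
  by (simp add: norm_unitization_def)

text \<open>The vector part acts as u minus its scalar part, and each of these two contributes at
  most \<open>norm u\<close>; hence the 2. Together with \<open>norm_scalar_part_le\<close> and
  \<open>norm_unitization_le\<close> this reduces completeness to the two components.\<close>

lemma norm_vector_part_le: "norm (vector_part u) \<le> 2 * norm (u :: 'a::cstar_algebra unitization)"
proof -
  have "Unitization 0 (vector_part u) = u - scalar_part u *\<^sub>C 1"
    by (simp add: unitization.expand)
  then have "left_op (Unitization 0 (vector_part u)) x = left_op u x - scalar_part u *\<^sub>C x" for x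
    by (simp add: left_op_def)
  then have "norm (left_op (Unitization 0 (vector_part u)) x) \<le> (onorm (left_op u) + cmod (scalar_part u)) * norm x" for x
    using norm_triangle_ineq4[of "left_op u x" "scalar_part u *\<^sub>C x"] onorm[OF bounded_linear_left_op, of u x]
    by (simp add: norm_scaleC distrib_right)
  then have "onorm (left_op (Unitization 0 (vector_part u))) \<le> onorm (left_op u) + cmod (scalar_part u)"
    by (intro onorm_bound) (simp_all add: onorm_pos_le bounded_linear_left_op)
  then show ?thesis
    using norm_le_onorm_left_op[of "Unitization 0 (vector_part u)"] by (simp add: norm_unitization_def)
qed

lemma norm_unitization_le: "norm u \<le> cmod (scalar_part u) + norm (vector_part (u :: 'a::cstar_algebra unitization))"
  using onorm_left_op_le[of u] by (simp add: norm_unitization_def)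

instance unitization :: (cstar_algebra) banach
proof
  fix X :: "nat \<Rightarrow> 'a unitization"
  assume X: "Cauchy X"
  have "Cauchy (\<lambda>n. scalar_part (X n))"
  proof (rule metric_CauchyI)
    fix e :: real assume "0 < e"
    then obtain M where M: "\<And>m n. m \<ge> M \<Longrightarrow> n \<ge> M \<Longrightarrow> norm (X m - X n) < e"
      using X unfolding Cauchy_iff by blast
    have "dist (scalar_part (X m)) (scalar_part (X n)) < e" if "m \<ge> M" "n \<ge> M" for m n
      using M[OF that] norm_scalar_part_le[of "X m - X n"] by (simp add: dist_norm)
    then show "\<exists>M. \<forall>m\<ge>M. \<forall>n\<ge>M. dist (scalar_part (X m)) (scalar_part (X n)) < e"
      by blast
  qed
  then obtain l where l: "(\<lambda>n. scalar_part (X n)) \<longlonglongrightarrow> l"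
    using Cauchy_convergent convergent_def by blast
  have "Cauchy (\<lambda>n. vector_part (X n))"
  proof (rule metric_CauchyI)
    fix e :: real assume "0 < e"
    then obtain M where M: "\<And>m n. m \<ge> M \<Longrightarrow> n \<ge> M \<Longrightarrow> norm (X m - X n) < e / 2"
      using X unfolding Cauchy_iff by (meson half_gt_zero)
    have "dist (vector_part (X m)) (vector_part (X n)) < e" if "m \<ge> M" "n \<ge> M" for m n
      using M[OF that] norm_vector_part_le[of "X m - X n"] by (simp add: dist_norm)
    then show "\<exists>M. \<forall>m\<ge>M. \<forall>n\<ge>M. dist (vector_part (X m)) (vector_part (X n)) < e"
      by blast
  qed
  then obtain a where a: "(\<lambda>n. vector_part (X n)) \<longlonglongrightarrow> a"
    using Cauchy_convergent convergent_def by blast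
  have "(\<lambda>n. cmod (scalar_part (X n) - l) + norm (vector_part (X n) - a)) \<longlonglongrightarrow> 0 + 0"
    using l a by (intro tendsto_add tendsto_norm_zero) (auto simp: LIM_zero_iff)
  then have *: "(\<lambda>n. cmod (scalar_part (X n) - l) + norm (vector_part (X n) - a)) \<longlonglongrightarrow> 0"
    by simp
  have "(\<lambda>n. norm (X n - Unitization l a)) \<longlonglongrightarrow> 0"
  proof (rule tendsto_sandwich[OF _ _ tendsto_const *])
    show "\<forall>\<^sub>F n in sequentially. norm (X n - Unitization l a)
        \<le> cmod (scalar_part (X n) - l) + norm (vector_part (X n) - a)"
      using norm_unitization_le[of "X n - Unitization l a" for n] by simp
  qed simp
  then have "X \<longlonglongrightarrow> Unitization l a"
    by (simp add: LIM_zero_iff tendsto_norm_zero_iff)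
  then show "convergent X"
    by (rule convergentI)
qed

instance unitization :: (cstar_algebra) cstar_algebra_1
proof
  fix x :: "'a unitization" and r :: real and z :: complex
  show "r *\<^sub>R x = complex_of_real r *\<^sub>C x"
    by (simp add: scaleR_unitization_def)
  show "norm (star x * x) = (norm x)\<^sup>2"
    unfolding norm_unitization_def onorm_left_op_star_mult
  proof -
    have "max (s\<^sup>2) (t\<^sup>2) = (max s t)\<^sup>2" if "0 \<le> s" "0 \<le> t" for s t :: real
      using that by (simp add: max_def)
    then show "max (cmod (scalar_part (star x * x))) ((onorm (left_op x))\<^sup>2)
        = (max (cmod (scalar_part x)) (onorm (left_op x)))\<^sup>2"
      using onorm_pos_le[OF bounded_linear_left_op[of x]] by (simp add: norm_mult power2_eq_square)
  qed
  show "norm (z *\<^sub>C x) = cmod z * norm x"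
  proof (rule antisym)
    have *: "norm (z *\<^sub>C x) \<le> cmod z * norm x" for z and x :: "'a unitization"
    proof -
      have "norm (left_op (z *\<^sub>C x) v) \<le> (cmod z * onorm (left_op x)) * norm v" for v
        using onorm[OF bounded_linear_left_op[of x], of v]
        by (simp add: left_op_algebra norm_scaleC mult.assoc mult_left_mono)
      then have "onorm (left_op (z *\<^sub>C x)) \<le> cmod z * onorm (left_op x)"
        by (rule onorm_bound[rotated]) (simp add: onorm_pos_le bounded_linear_left_op)
      also have "\<dots> \<le> cmod z * norm x"
        by (simp add: norm_unitization_def mult_left_mono)
      finally show ?thesis
        by (simp add: norm_unitization_def[of "z *\<^sub>C x"] norm_mult mult_left_mono norm_scalar_part_le)
    qed
    show "norm (z *\<^sub>C x) \<le> cmod z * norm x" by (rule *)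
    show "cmod z * norm x \<le> norm (z *\<^sub>C x)"
    proof (cases "z = 0")
      case False
      have "cmod z * norm x = cmod z * norm (inverse z *\<^sub>C (z *\<^sub>C x))"
        using False by (simp add: scaleC_scaleC scaleC_one)
      also have "\<dots> \<le> cmod z * (cmod (inverse z) * norm (z *\<^sub>C x))"
        by (intro mult_left_mono *) simp
      also have "\<dots> = (cmod z * inverse (cmod z)) * norm (z *\<^sub>C x)"
        by (simp add: norm_inverse)
      finally show ?thesis using False by simp
    qed simp
  qed
qed

section \<open>Sums of squares in matrix algebras over a C*-algebra\<close>

lemma pos_sum: "(\<And>i. i \<in> A \<Longrightarrow> pos (f i)) \<Longrightarrow> pos (sum f A)"
  by (induction A rule: infinite_finite_induct) (simp_all add: pos_add)

text \<open>Since |c - z|^2 is positive, |c + z|^2 is at most 2 |c|^2 + 2 |z|^2, and each new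
  summand turns K into 2K + 2. What matters is only that K does not depend on c.\<close>

lemma pos_star_sum_mult_sum:
  assumes "finite A"
  shows "\<exists>K\<ge>0. \<forall>c. pos (K *\<^sub>R (\<Sum>a\<in>A. star (c a) * c a)
    - star (\<Sum>a\<in>A. c a) * (\<Sum>a\<in>A. c a :: 'b::cstar_algebra_1))"
  using assms
proof (induction A rule: finite_induct)
  case empty
  show ?case by (auto intro!: exI[of _ 0])
next
  case (insert a A)
  then obtain K where K: "K \<ge> 0"
    "\<And>c. pos (K *\<^sub>R (\<Sum>a\<in>A. star (c a) * c a)
      - star (\<Sum>a\<in>A. c a) * (\<Sum>a\<in>A. c a :: 'b))"
    by blast
  have "pos ((2 * K + 2) *\<^sub>R (\<Sum>a\<in>insert a A. star (c a) * c a)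
    - star (\<Sum>a\<in>insert a A. c a) * (\<Sum>a\<in>insert a A. c a))" for c :: "_ \<Rightarrow> 'b"
  proof -
    define s where "s = (\<Sum>a\<in>A. star (c a) * c a)"
    define z where "z = (\<Sum>a\<in>A. c a)"
    have "pos (star (c a - z) * (c a - z) + 2 *\<^sub>R (K *\<^sub>R s - star z * z)
        + (2 * K) *\<^sub>R (star (c a) * c a) + 2 *\<^sub>R s)"
      using K by (intro pos_add pos_scaleR pos_star_mult) (auto simp: s_def z_def intro: pos_sum pos_star_mult)
    also have "star (c a - z) * (c a - z) + 2 *\<^sub>R (K *\<^sub>R s - star z * z)
        + (2 * K) *\<^sub>R (star (c a) * c a) + 2 *\<^sub>R s
        = (2 * K + 2) *\<^sub>R (star (c a) * c a + s) - star (c a + z) * (c a + z)"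
      by (simp add: star_add star_diff algebra_simps scaleR_2)
    finally show ?thesis
      using insert by (simp add: s_def z_def)
  qed
  then show ?case using K(1) by (intro exI[of _ "2 * K + 2"]) auto
qed

text \<open>In terms of matrices: \<open>P\<^sup>2 \<le> t P\<close> for \<open>P = W\<^sup>* W\<close>, tested on vectors.\<close>

lemma gram_sq_le:
  fixes W :: "'i \<Rightarrow> nat \<Rightarrow> 'a::cstar_algebra_1"
  assumes I: "finite I"
  obtains t where "t > 0"
    "\<And>y. pos (t *\<^sub>R (\<Sum>a\<in>I. star (y a) * y a)
      - (\<Sum>i<n. star (\<Sum>a\<in>I. star (W a i) * y a) * (\<Sum>a\<in>I. star (W a i) * y a)))"
proof -
  obtain K where K: "K \<ge> 0"
    "\<And>c. pos (K *\<^sub>R (\<Sum>a\<in>I. star (c a) * c a)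
      - star (\<Sum>a\<in>I. c a) * (\<Sum>a\<in>I. c a :: 'a))"
    using pos_star_sum_mult_sum[OF I] by blast
  \<comment> \<open>K pays for the square of a sum over I, the squared norms for pulling the
    \<open>W a i\<close> out of the squares, and the 1 makes t invertible.\<close>
  define t where "t = K * (\<Sum>a\<in>I. \<Sum>i<n. (norm (W a i))\<^sup>2) + 1"
  have t: "t > 0"
    unfolding t_def using K(1) by (intro add_nonneg_pos mult_nonneg_nonneg sum_nonneg) auto
  have "pos (t *\<^sub>R (\<Sum>a\<in>I. star (y a) * y a)
      - (\<Sum>i<n. star (\<Sum>a\<in>I. star (W a i) * y a) * (\<Sum>a\<in>I. star (W a i) * y a)))" for y
  proof -
    let ?c = "\<lambda>i a. star (W a i) * y a"
    let ?w = "\<lambda>a. K * (\<Sum>i<n. (norm (W a i))\<^sup>2)"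
    have w: "?w a \<le> t" if "a \<in> I" for a
    proof -
      have "(\<Sum>i<n. (norm (W a i))\<^sup>2) \<le> (\<Sum>a\<in>I. \<Sum>i<n. (norm (W a i))\<^sup>2)"
        by (rule member_le_sum[OF that]) (auto intro: sum_nonneg I)
      then show ?thesis
        unfolding t_def using K(1) by (smt (verit) mult_left_mono)
    qed
    \<comment> \<open>Three positive groups: the slack in t, the compressions weighted by K, and the
      estimate of each squared sum. The squares of the single \<open>?c i a\<close> cancel between
      the last two.\<close>
    have "pos ((\<Sum>a\<in>I. (t - ?w a) *\<^sub>R (star (y a) * y a))
        + K *\<^sub>R (\<Sum>i<n. \<Sum>a\<in>I. (norm (W a i))\<^sup>2 *\<^sub>R (star (y a) * y a) - star (?c i a) * ?c i a)
        + (\<Sum>i<n. K *\<^sub>R (\<Sum>a\<in>I. star (?c i a) * ?c i a)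
            - star (\<Sum>a\<in>I. ?c i a) * (\<Sum>a\<in>I. ?c i a)))"
      using K w pos_compress[of "star (W a i)" "y a" for a i]
      by (intro pos_add pos_scaleR pos_sum pos_star_mult) (auto simp: pos_star_mult)
    also have "(\<Sum>a\<in>I. (t - ?w a) *\<^sub>R (star (y a) * y a))
        = t *\<^sub>R (\<Sum>a\<in>I. star (y a) * y a)
          - K *\<^sub>R (\<Sum>i<n. \<Sum>a\<in>I. (norm (W a i))\<^sup>2 *\<^sub>R (star (y a) * y a))"
    proof -
      have "(\<Sum>i<n. \<Sum>a\<in>I. (norm (W a i))\<^sup>2 *\<^sub>R (star (y a) * y a))
          = (\<Sum>a\<in>I. (\<Sum>i<n. (norm (W a i))\<^sup>2) *\<^sub>R (star (y a) * y a))"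
        by (subst sum.swap) (simp add: scaleR_sum_left)
      then show ?thesis
        by (simp add: scaleR_diff_left sum_subtractf scaleR_sum_right)
    qed
    finally show ?thesis
      by (simp only: sum_subtractf scaleR_diff_right scaleR_sum_right algebra_simps) simp
  qed
  then show thesis using that t by blast
qed

text \<open>The size n is a variable, so the n by n matrices form no type on which
  \<open>sqrt_ser\<close> could act. The matrix T = 1 - P/t and its powers E k are therefore treated
  entrywise, and the series for the root of 1 - T = P/t is summed in every entry.\<close>

lemma gram_square_unital:
  fixes W :: "'i \<Rightarrow> nat \<Rightarrow> 'a::cstar_algebra_1"
  assumes I: "finite I"
  obtains Z :: "nat \<Rightarrow> nat \<Rightarrow> 'a"
  where "\<And>p q. p < n \<Longrightarrow> q < n \<Longrightarrow>
    (\<Sum>a\<in>I. star (W a p) * W a q) = (\<Sum>m<n. star (Z m p) * Z m q)"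
proof -
  obtain t where t: "t > 0"
    and le: "\<And>y. pos (t *\<^sub>R (\<Sum>a\<in>I. star (y a) * y a)
      - (\<Sum>i<n. star (\<Sum>a\<in>I. star (W a i) * y a) * (\<Sum>a\<in>I. star (W a i) * y a)))"
    using gram_sq_le[OF I] by blast
  define P where "P i j = (\<Sum>a\<in>I. star (W a i) * W a j)" for i j
  define T where "T i j = (if i = j then 1 else 0) - inverse t *\<^sub>R P i j" for i j
  define E where "E = rec_nat (\<lambda>i j. if i = j then 1 else 0) (\<lambda>_ E i j. \<Sum>l<n. T i l * E l j)"
  have E0: "E 0 i j = (if i = j then 1 else 0)" for i j
    by (simp add: E_def)
  have ES: "E (Suc k) i j = (\<Sum>l<n. T i l * E k l j)" for k i j
    by (simp add: E_def)
  have E1: "E 1 i j = T i j" if "j < n" for i j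
    using that by (simp add: ES E0 if_distrib[of "\<lambda>x. _ * x"] cong: if_cong)
  \<comment> \<open>With y = W x and z = P x, the difference equals (1/t) <y, y> + (1/t^2) (t <y, y>
    - <z, z>), and the bracket is positive by \<open>le\<close>.\<close>
  have contract: "pos ((\<Sum>i<n. star (x i) * x i)
      - (\<Sum>i<n. star (\<Sum>l<n. T i l * x l) * (\<Sum>l<n. T i l * x l)))" for x :: "nat \<Rightarrow> 'a"
  proof -
    define y where "y a = (\<Sum>j<n. W a j * x j)" for a
    define z where "z i = (\<Sum>a\<in>I. star (W a i) * y a)" for i
    have Px: "(\<Sum>j<n. P i j * x j) = z i" for i
      unfolding z_def y_def P_def sum_distrib_left sum_distrib_right
      by (subst sum.swap) (simp add: mult.assoc)
    have Tx: "(\<Sum>l<n. T i l * x l) = x i - inverse t *\<^sub>R z i" if "i < n" for i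
      using that unfolding Px[symmetric]
      by (simp add: T_def left_diff_distrib sum_subtractf scaleR_sum_right
          if_distrib[of "\<lambda>u. u * _"] cong: if_cong)
    have xz: "(\<Sum>i<n. star (x i) * z i) = (\<Sum>a\<in>I. star (y a) * y a)"
      unfolding z_def sum_distrib_left
      by (subst sum.swap) (simp add: y_def star_sum star_mult sum_distrib_right mult.assoc)
    have zx: "(\<Sum>i<n. star (z i) * x i) = (\<Sum>a\<in>I. star (y a) * y a)"
    proof -
      have "star (\<Sum>i<n. star (x i) * z i) = star (\<Sum>a\<in>I. star (y a) * y a)"
        by (simp only: xz)
      then show ?thesis by (simp add: star_sum star_mult)
    qed
    have "(\<Sum>i<n. star (x i) * x i) - (\<Sum>i<n. star (\<Sum>l<n. T i l * x l) * (\<Sum>l<n. T i l * x l))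
        = (\<Sum>i<n. star (x i) * x i - star (x i - inverse t *\<^sub>R z i) * (x i - inverse t *\<^sub>R z i))"
      by (simp add: sum_subtractf Tx)
    also have "\<dots> = (\<Sum>i<n. inverse t *\<^sub>R (star (x i) * z i) + inverse t *\<^sub>R (star (z i) * x i)
        - (inverse t * inverse t) *\<^sub>R (star (z i) * z i))"
      by (rule sum.cong) (simp_all add: star_diff star_scaleR algebra_simps)
    also have "\<dots> = inverse t *\<^sub>R (\<Sum>a\<in>I. star (y a) * y a)
        + inverse t *\<^sub>R (\<Sum>a\<in>I. star (y a) * y a)
        - (inverse t * inverse t) *\<^sub>R (\<Sum>i<n. star (z i) * z i)"
      by (simp only: sum_subtractf sum.distrib scaleR_sum_right[symmetric] xz zx)
    also have "\<dots> = inverse t *\<^sub>R (\<Sum>a\<in>I. star (y a) * y a)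
        + (inverse t * inverse t) *\<^sub>R (t *\<^sub>R (\<Sum>a\<in>I. star (y a) * y a) - (\<Sum>i<n. star (z i) * z i))"
      using t by (simp add: scaleR_diff_right)
    also have "pos \<dots>"
      using t le[of y] unfolding z_def
      by (intro pos_add pos_scaleR pos_sum pos_star_mult) auto
    finally show ?thesis .
  qed
  \<comment> \<open>Column j of E k is the k-th image of a basis vector under the contraction T, so
    its squared length stays at most 1 and dominates the square of each entry.\<close>
  have bound: "norm (E k i j) \<le> 1" if "i < n" "j < n" for k i j
  proof -
    have "pos (1 - (\<Sum>i<n. star (E k i j) * E k i j))"
    proof (induction k)
      case 0
      show ?case using \<open>j < n\<close> by (simp add: E0 if_distrib[of star] if_distrib[of "\<lambda>x. _ * x"] cong: if_cong)
    next
      case (Suc k)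
      have "pos ((1 - (\<Sum>i<n. star (E k i j) * E k i j)) +
          ((\<Sum>i<n. star (E k i j) * E k i j) - (\<Sum>i<n. star (E (Suc k) i j) * E (Suc k) i j)))"
        using pos_add[OF Suc contract[of "\<lambda>i. E k i j"]] by (simp only: ES)
      then show ?case by simp
    qed
    moreover have "pos ((\<Sum>i<n. star (E k i j) * E k i j) - star (E k i j) * E k i j)"
    proof -
      have "(\<Sum>i<n. star (E k i j) * E k i j) - star (E k i j) * E k i j
          = (\<Sum>l\<in>{..<n} - {i}. star (E k l j) * E k l j)"
        using that by (subst sum.remove[of _ i]) auto
      then show ?thesis by (simp add: pos_sum pos_star_mult)
    qed
    ultimately have "pos (1 - star (E k i j) * E k i j)"
      using pos_add by fastforce
    then have "norm (star (E k i j) * E k i j) \<le> norm (1 :: 'a)"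
      by (intro pos_norm_mono pos_star_mult)
    then show ?thesis
      by (simp add: cstar_identity) (simp add: abs_square_le_1)
  qed
  have semigroup: "(\<Sum>l<n. E a i l * E b l j) = E (a + b) i j" if "i < n" for a b i j
    using that
  proof (induction a arbitrary: i)
    case 0
    then show ?case by (simp add: E0 if_distrib[of "\<lambda>u. u * _"] cong: if_cong)
  next
    case (Suc a)
    have "(\<Sum>l<n. E (Suc a) i l * E b l j) = (\<Sum>m<n. T i m * (\<Sum>l<n. E a m l * E b l j))"
      unfolding ES sum_distrib_left sum_distrib_right by (subst sum.swap) (simp add: mult.assoc)
    then show ?case using Suc by (simp add: ES)
  qed
  have T_star: "star (T i j) = T j i" for i j
    by (auto simp: T_def P_def star_diff star_scaleR star_sum star_mult)
  have E_star: "star (E k i j) = E k j i" if "i < n" "j < n" for k i j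
    using that
  proof (induction k arbitrary: i j)
    case 0
    then show ?case by (simp add: E0)
  next
    case (Suc k)
    have "star (E (Suc k) i j) = (\<Sum>l<n. E k j l * T l i)"
      using Suc by (simp add: ES[of k] star_sum star_mult T_star)
    also have "\<dots> = (\<Sum>l<n. E k j l * E 1 l i)"
      using Suc by (simp only: E1)
    also have "\<dots> = E (Suc k) j i"
      using Suc by (simp add: semigroup)
    finally show ?case .
  qed
  have summ: "summable (\<lambda>k. norm (sqrt_coeff k *\<^sub>R E k i j))" if "i < n" "j < n" for i j
    by (rule summable_comparison_test'[OF summable_abs_sqrt_coeff, of 0])
      (use bound[OF that] in \<open>simp add: mult_left_le\<close>)
  define S where "S i j = (\<Sum>k. sqrt_coeff k *\<^sub>R E k i j)" for i j
  have S_star: "star (S i j) = S j i" if "i < n" "j < n" for i j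
    unfolding S_def
    using bounded_linear.suminf[OF bounded_linear_star summable_norm_cancel[OF summ[OF that]]]
    by (simp add: star_scaleR E_star that)
  have S_sq: "(\<Sum>l<n. S i l * S l j) = inverse t *\<^sub>R P i j" if ij: "i < n" "j < n" for i j
  proof -
    have "(\<lambda>m. \<Sum>l<n. \<Sum>a\<le>m. (sqrt_coeff a *\<^sub>R E a i l) * (sqrt_coeff (m - a) *\<^sub>R E (m - a) l j))
        sums (\<Sum>l<n. S i l * S l j)"
      unfolding S_def using ij by (intro sums_sum Cauchy_product_sums summ) auto
    moreover have "(\<Sum>l<n. \<Sum>a\<le>m. (sqrt_coeff a *\<^sub>R E a i l) * (sqrt_coeff (m - a) *\<^sub>R E (m - a) l j))
        = (if m \<in> {0, 1} then (if m = 0 then E 0 i j else - E 1 i j) else 0)" for m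
    proof -
      have "(\<Sum>l<n. \<Sum>a\<le>m. (sqrt_coeff a *\<^sub>R E a i l) * (sqrt_coeff (m - a) *\<^sub>R E (m - a) l j))
          = (\<Sum>a\<le>m. (sqrt_coeff a * sqrt_coeff (m - a)) *\<^sub>R (\<Sum>l<n. E a i l * E (m - a) l j))"
        unfolding scaleR_sum_right by (subst sum.swap) (intro sum.cong refl, simp add: mult.commute)
      also have "\<dots> = (\<Sum>a\<le>m. sqrt_coeff a * sqrt_coeff (m - a)) *\<^sub>R E m i j"
        using ij by (simp add: semigroup scaleR_sum_left)
      finally show ?thesis by (auto simp: sqrt_coeff_convolution)
    qed
    ultimately have "(\<lambda>m. if m \<in> {0, 1} then (if m = 0 then E 0 i j else - E 1 i j) else 0)
        sums (\<Sum>l<n. S i l * S l j)"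
      by simp
    moreover have "(\<lambda>m. if m \<in> {0, 1} then (if m = 0 then E 0 i j else - E 1 i j) else 0)
        sums (\<Sum>m\<in>{0, 1::nat}. if m = 0 then E 0 i j else - E 1 i j)"
      by (rule sums_If_finite_set) simp
    ultimately have "(\<Sum>l<n. S i l * S l j) = E 0 i j - E 1 i j"
      using sums_unique2 by fastforce
    then show ?thesis using ij by (simp add: E0 E1[unfolded One_nat_def] T_def)
  qed
  show thesis
  proof (rule that[of "\<lambda>i j. sqrt t *\<^sub>R S i j"])
    fix p q assume pq: "p < n" "q < n"
    have "(\<Sum>m<n. star (sqrt t *\<^sub>R S m p) * (sqrt t *\<^sub>R S m q)) = t *\<^sub>R (\<Sum>m<n. S p m * S m q)"
      using pq t by (simp add: star_scaleR S_star scaleR_sum_right)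
    also have "\<dots> = P p q"
      using t by (simp add: S_sq pq)
    finally show "(\<Sum>a\<in>I. star (W a p) * W a q)
        = (\<Sum>m<n. star (sqrt t *\<^sub>R S m p) * (sqrt t *\<^sub>R S m q))"
      by (simp add: P_def)
  qed
qed

text \<open>The root computed in the unitization stays in the algebra: the scalar parts of the
  diagonal of the Gram matrix vanish, and they are sums of squared moduli of the scalar parts of
  Z.\<close>

theorem gram_square:
  fixes W :: "'i \<Rightarrow> nat \<Rightarrow> 'a::cstar_algebra"
  assumes I: "finite I"
  obtains Z :: "nat \<Rightarrow> nat \<Rightarrow> 'a"
  where "\<And>p q. p < n \<Longrightarrow> q < n \<Longrightarrow>
    (\<Sum>a\<in>I. star (W a p) * W a q) = (\<Sum>m<n. star (Z m p) * Z m q)"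
proof -
  obtain Z :: "nat \<Rightarrow> nat \<Rightarrow> 'a unitization" where Z: "\<And>p q. p < n \<Longrightarrow> q < n \<Longrightarrow>
      (\<Sum>a\<in>I. star (Unitization 0 (W a p)) * Unitization 0 (W a q)) = (\<Sum>m<n. star (Z m p) * Z m q)"
    using gram_square_unital[OF I, of n "\<lambda>a p. Unitization 0 (W a p)"] by blast
  have sc: "scalar_part (sum f A) = (\<Sum>a\<in>A. scalar_part (f a))"
    and vc: "vector_part (sum f A) = (\<Sum>a\<in>A. vector_part (f a))"
    for f :: "'x \<Rightarrow> 'a unitization" and A
    by (induction A rule: infinite_finite_induct) simp_all
  have z: "scalar_part (Z m p) = 0" if "m < n" "p < n" for m p
  proof -
    have "0 = scalar_part (\<Sum>m<n. star (Z m p) * Z m p)"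
      unfolding Z[OF \<open>p < n\<close> \<open>p < n\<close>, symmetric] by (simp add: sc)
    also have "\<dots> = complex_of_real (\<Sum>m<n. (cmod (scalar_part (Z m p)))\<^sup>2)"
      by (simp add: sc mult.commute[of "cnj _"] complex_norm_square del: of_real_power)
    finally have "(\<Sum>m<n. (cmod (scalar_part (Z m p)))\<^sup>2) = 0"
      by (metis of_real_eq_0_iff)
    then show ?thesis using that by (simp add: sum_nonneg_eq_0_iff)
  qed
  show thesis
  proof (rule that[of "\<lambda>m p. vector_part (Z m p)"])
    fix p q assume "p < n" "q < n"
    then show "(\<Sum>a\<in>I. star (W a p) * W a q) = (\<Sum>m<n. star (vector_part (Z m p)) * vector_part (Z m q))"
      using arg_cong[OF Z[of p q], of vector_part] by (simp add: vc z)
  qed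
qed

section \<open>Spectral decomposition in finite dimension\<close>

definition poly_apply :: "complex poly \<Rightarrow> 'a::cstar_algebra_1 \<Rightarrow> 'a"
  where "poly_apply p a = fold_coeffs (\<lambda>c y. c *\<^sub>C 1 + a * y) p 0"

lemma poly_apply_0 [simp]: "poly_apply 0 a = 0"
  by (simp add: poly_apply_def)

lemma poly_apply_pCons [simp]: "poly_apply (pCons c p) a = c *\<^sub>C 1 + a * poly_apply p a"
  by (cases "p = 0 \<and> c = 0") (auto simp: poly_apply_def)

lemma poly_apply_add: "poly_apply (p + q) a = poly_apply p a + poly_apply q a"
  by (induction p q rule: poly_induct2) (simp_all add: scaleC_add_left algebra_simps)

lemma poly_apply_smult: "poly_apply (smult c p) a = c *\<^sub>C poly_apply p a"
  by (induction p) (simp_all add: scaleC_add_right scaleC_scaleC scaleC_mult_right)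

lemma poly_apply_monom: "poly_apply (monom c n) a = c *\<^sub>C a ^ n"
  by (induction n) (simp_all add: monom_0 monom_Suc scaleC_mult_right)

lemma poly_apply_sum: "poly_apply (sum f A) a = (\<Sum>i\<in>A. poly_apply (f i) a)"
  by (induction A rule: infinite_finite_induct) (simp_all add: poly_apply_add)

lemma poly_apply_linear_mult: "poly_apply ([:- z, 1:] * p) a = (a - z *\<^sub>C 1) * poly_apply p a"
proof -
  have "[:- z, 1:] * p = smult (- z) p + pCons 0 p" by simp
  then show ?thesis
    by (simp only: poly_apply_add poly_apply_smult poly_apply_pCons)
      (simp add: scaleC_minus_left scaleC_mult_left algebra_simps)
qed

lemma poly_apply_commute: "poly_apply p a * a = a * poly_apply p a"
  by (induction p) (simp_all add: algebra_simps scaleC_mult_left scaleC_mult_right)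

lemma annihilating_poly:
  assumes "finite_dim TYPE('a::cstar_algebra_1)"
  obtains p where "p \<noteq> 0" "poly_apply p (a :: 'a) = 0"
proof -
  interpret vector_space "scaleC :: complex \<Rightarrow> 'a \<Rightarrow> 'a"
    by (rule vector_space_scaleC)
  obtain T :: "'a set" where T: "finite T" "span T = UNIV"
    using assms by (auto simp: finite_dim_def)
  show thesis
  \<comment> \<open>Linear dependence is a property of sets, so coinciding powers, which shrink the
    set, get a polynomial of their own.\<close>
  proof (cases "inj_on (\<lambda>i. a ^ i) {..card T}")
    case False
    then obtain i j where ij: "a ^ i = a ^ j" "i \<noteq> j"
      by (auto simp: inj_on_def)
    have "monom 1 i - monom (1 :: complex) j \<noteq> 0"
      using \<open>i \<noteq> j\<close> by (simp add: monom_eq_iff')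
    moreover have "poly_apply (monom 1 i + monom (- 1) j) a = 0"
      by (simp add: poly_apply_add poly_apply_monom ij scaleC_minus_left)
    ultimately show thesis
      using that[of "monom 1 i + monom (- 1) j"] by (simp add: minus_monom[symmetric])
  next
    case True
    define S where "S = (\<lambda>i. a ^ i) ` {..card T}"
    have "card S = Suc (card T)"
      using card_image[OF True] by (simp add: S_def)
    then have "dependent S"
      using independent_span_bound[OF T(1), of S] T(2) by auto
    moreover have "finite S" by (simp add: S_def)
    ultimately obtain u where u: "\<exists>v\<in>S. u v \<noteq> 0" "(\<Sum>v\<in>S. u v *\<^sub>C v) = 0"
      by (auto simp: dependent_finite)
    define p where "p = (\<Sum>i\<le>card T. monom (u (a ^ i)) i)"
    have "coeff p i = u (a ^ i)" if "i \<le> card T" for i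
      using that by (simp add: p_def coeff_sum if_distrib cong: if_cong)
    then have "p \<noteq> 0"
      using u(1) by (force simp: S_def)
    moreover have "poly_apply p a = (\<Sum>v\<in>S. u v *\<^sub>C v)"
      unfolding p_def S_def by (simp add: poly_apply_sum poly_apply_monom sum.reindex[OF True])
    ultimately show thesis using that u(2) by simp
  qed
qed

text \<open>Eigenvectors are elements of the algebra, on which a acts by left multiplication, and
  \<open>star x * y\<close> takes the place of the inner product. As for operators, the point is
  that \<open>star x * (a * x)\<close> is self-adjoint.\<close>

lemma selfadj_eigenvalue_real:
  assumes a: "star a = a" and x: "a * x = z *\<^sub>C x" and z: "Im z \<noteq> 0"
  shows "x = (0 :: 'a::cstar_algebra_1)"
proof -
  have "star x * (a * x) = z *\<^sub>C (star x * x)"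
    by (simp add: x scaleC_mult_right)
  moreover have "star x * (a * x) = star (star x * (a * x))"
    by (simp add: star_mult a mult.assoc)
  ultimately have "z *\<^sub>C (star x * x) = cnj z *\<^sub>C (star x * x)"
    by (simp add: star_scaleC star_mult)
  then have "(z - cnj z) *\<^sub>C (star x * x) = 0"
    by (simp add: scaleC_diff_left)
  then have "cmod (z - cnj z) * norm (star x * x) = 0"
    by (metis norm_scaleC norm_zero)
  moreover have "z - cnj z \<noteq> 0"
    using z by (auto simp: complex_eq_iff)
  ultimately show ?thesis by (simp add: star_mult_eq_0_iff)
qed

text \<open>Self-adjointness excludes Jordan blocks. For real z the element N = a - z is
  self-adjoint and the C*-identity applies to N x; for other z, N x is an eigenvector with a
  non-real eigenvalue, hence zero.\<close>

lemma selfadj_gen_eigenvector: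
  assumes a: "star a = a" and x: "(a - z *\<^sub>C 1) * ((a - z *\<^sub>C 1) * x) = 0"
  shows "(a - z *\<^sub>C 1) * x = (0 :: 'a::cstar_algebra_1)"
proof (cases "Im z = 0")
  case True
  then have "cnj z = z" by (simp add: complex_eq_iff)
  then have "star (a - z *\<^sub>C 1) = a - z *\<^sub>C 1"
    by (simp add: star_diff star_scaleC a)
  then have "star ((a - z *\<^sub>C 1) * x) * ((a - z *\<^sub>C 1) * x) = 0"
    by (simp add: star_mult mult.assoc x)
  then show ?thesis by (simp only: star_mult_eq_0_iff)
next
  case False
  show ?thesis
    by (rule selfadj_eigenvalue_real[OF a _ False])
      (use x in \<open>simp add: left_diff_distrib scaleC_mult_left\<close>)
qed

text \<open>Induction on linear factors. Splitting (a - w) x into eigenvectors and dividing the one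
  for z by z - w, for z other than w, gives components of x. The remainder is annihilated by (a -
  w)^2, hence by a - w, and is the component for w.\<close>

lemma eigenvector_sum:
  assumes a: "star a = a" and "p \<noteq> 0" and "poly_apply p a * x = (0 :: 'a::cstar_algebra_1)"
  shows "\<exists>S y. finite S \<and> x = (\<Sum>z\<in>S. y z) \<and> (\<forall>z\<in>S. a * y z = z *\<^sub>C y z)"
  using assms(2,3)
proof (induction "degree p" arbitrary: p x)
  case 0
  then obtain c where "p = [:c:]" "c \<noteq> 0"
    by (metis degree_eq_zeroE pCons_0_0)
  then have "c *\<^sub>C x = 0" using 0 by (simp add: scaleC_mult_left)
  then have "inverse c *\<^sub>C (c *\<^sub>C x) = 0" by simp
  then have "x = 0" using \<open>c \<noteq> 0\<close> by (simp add: scaleC_scaleC scaleC_one)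
  then show ?case by (intro exI[of _ "{}"]) auto
next
  case (Suc d)
  have "\<not> constant (poly p)"
    using Suc.hyps(2) by (simp add: constant_degree)
  then obtain w where "poly p w = 0"
    using fundamental_theorem_of_algebra by blast
  then obtain q where q: "p = [:- w, 1:] * q"
    by (meson dvdE poly_eq_0_iff_dvd)
  then have "q \<noteq> 0" using Suc.prems by auto
  then have "d = degree q"
    using Suc.hyps(2) unfolding q by (subst (asm) degree_mult_eq) auto
  let ?N = "a - w *\<^sub>C 1"
  have "poly_apply q a * (?N * x) = poly_apply p a * x"
    unfolding q poly_apply_linear_mult
    by (simp add: algebra_simps scaleC_mult_left scaleC_mult_right poly_apply_commute flip: mult.assoc)
  then obtain S y where S: "finite S" "?N * x = (\<Sum>z\<in>S. y z)" and y: "\<And>z. z \<in> S \<Longrightarrow> a * y z = z *\<^sub>C y z"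
    using Suc.hyps(1)[OF \<open>d = degree q\<close> \<open>q \<noteq> 0\<close>, of "?N * x"] Suc.prems(2) by auto
  define f where "f z = inverse (z - w) *\<^sub>C y z" for z
  have af: "a * f z = z *\<^sub>C f z" if "z \<in> S" for z
    using y[OF that] by (simp add: f_def scaleC_mult_right scaleC_scaleC mult.commute)
  have Nf: "?N * f z = y z" if "z \<in> S - {w}" for z
  proof -
    have "?N * f z = (z - w) *\<^sub>C f z"
      using af that by (simp add: left_diff_distrib scaleC_mult_left scaleC_diff_left)
    then show ?thesis using that by (simp add: f_def scaleC_scaleC scaleC_one)
  qed
  define r where "r = x - (\<Sum>z\<in>S - {w}. f z)"
  have "?N * r = (\<Sum>z\<in>S. y z) - (\<Sum>z\<in>S - {w}. y z)"
    unfolding r_def right_diff_distrib sum_distrib_left S(2) using Nf by simp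
  also have "\<dots> = (if w \<in> S then y w else 0)"
    using S(1) by (simp add: sum_diff1)
  finally have "?N * (?N * r) = 0"
    using y[of w] by (simp add: left_diff_distrib scaleC_mult_left)
  then have "?N * r = 0"
    by (rule selfadj_gen_eigenvector[OF a])
  then have r: "a * r = w *\<^sub>C r"
    by (simp add: left_diff_distrib scaleC_mult_left)
  define g where "g z = (if z = w then r else f z)" for z
  have "(\<Sum>z\<in>insert w (S - {w}). g z) = g w + (\<Sum>z\<in>S - {w}. g z)"
    using S(1) by (intro sum.insert) auto
  also have "(\<Sum>z\<in>S - {w}. g z) = (\<Sum>z\<in>S - {w}. f z)"
    by (rule sum.cong) (auto simp: g_def)
  finally have "x = (\<Sum>z\<in>insert w (S - {w}). g z)"
    by (simp add: g_def r_def)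
  moreover have "\<forall>z\<in>insert w (S - {w}). a * g z = z *\<^sub>C g z"
    using af r by (auto simp: g_def)
  ultimately show ?case
    using S(1) by (metis finite_Diff finite_insert)
qed

text \<open>The projections are the components of 1 in \<open>eigenvector_sum\<close>; the non-real
  ones vanish. Different eigenvalues give orthogonal components, so multiplying 1 by
  \<open>star (p l)\<close> yields \<open>star (p l) = star (p l) * p l\<close>, which contains both
  self-adjointness and idempotence.\<close>

lemma spectral_decomposition:
  assumes fd: "finite_dim TYPE('a::cstar_algebra_1)" and a: "star a = (a :: 'a)"
  obtains S :: "real set" and p where "finite S" "(\<Sum>l\<in>S. p l) = 1"
    "\<And>l. l \<in> S \<Longrightarrow> a * p l = complex_of_real l *\<^sub>C p l" "\<And>l. l \<in> S \<Longrightarrow> star (p l) = p l"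
    "\<And>l m. l \<in> S \<Longrightarrow> m \<in> S \<Longrightarrow> p l * p m = (if l = m then p l else 0)"
proof -
  obtain f where "f \<noteq> 0" "poly_apply f a = 0"
    using annihilating_poly[OF fd] by blast
  then obtain C y where C: "finite C" "1 = (\<Sum>z\<in>C. y z)" "\<And>z. z \<in> C \<Longrightarrow> a * y z = z *\<^sub>C y z"
    using eigenvector_sum[OF a, of f 1] by auto
  define S where "S = Re ` (C \<inter> \<real>)"
  define p where "p l = y (complex_of_real l)" for l
  have inj: "inj_on Re (C \<inter> \<real>)"
    by (auto simp: inj_on_def Reals_def)
  have S: "finite S" using C(1) by (simp add: S_def)
  have CS: "complex_of_real l \<in> C" if "l \<in> S" for l
    using that by (auto simp: S_def Reals_def)
  have one: "(\<Sum>l\<in>S. p l) = 1"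
  proof -
    have "1 = (\<Sum>z\<in>C \<inter> \<real>. y z)"
      unfolding C(2) using C(1,3) selfadj_eigenvalue_real[OF a, of "y z" z for z]
      by (intro sum.mono_neutral_right) (auto simp: complex_is_Real_iff)
    also have "\<dots> = (\<Sum>l\<in>S. p l)"
      unfolding S_def sum.reindex[OF inj] by (rule sum.cong) (auto simp: p_def)
    finally show ?thesis ..
  qed
  have ap: "a * p l = complex_of_real l *\<^sub>C p l" if "l \<in> S" for l
    using C(3)[OF CS[OF that]] by (simp add: p_def)
  have orth: "star (p l) * p m = 0" if "l \<in> S" "m \<in> S" "l \<noteq> m" for l m
  proof -
    have "complex_of_real m *\<^sub>C (star (p l) * p m) = star (p l) * (a * p m)"
      using that by (simp add: ap scaleC_mult_right)
    also have "\<dots> = star (a * p l) * p m"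
      by (simp add: star_mult a mult.assoc)
    also have "\<dots> = complex_of_real l *\<^sub>C (star (p l) * p m)"
      using that by (simp add: ap star_scaleC scaleC_mult_left)
    finally have "(m - l) *\<^sub>R (star (p l) * p m) = 0"
      by (simp add: scaleR_diff_left scaleR_scaleC scaleC_diff_left)
    then show ?thesis using that by simp
  qed
  have sq: "star (p l) * p l = star (p l)" if "l \<in> S" for l
  proof -
    have "star (p l) = star (p l) * (\<Sum>m\<in>S. p m)" by (simp add: one)
    also have "\<dots> = (\<Sum>m\<in>S. if m = l then star (p l) * p l else 0)"
      unfolding sum_distrib_left using that orth by (intro sum.cong) auto
    finally show ?thesis using S that by simp
  qed
  have sp: "star (p l) = p l" if "l \<in> S" for l
    by (metis sq[OF that] star_mult star_star)
  show thesis
  proof (rule that[OF S one ap sp])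
    fix l m assume "l \<in> S" "m \<in> S"
    then show "p l * p m = (if l = m then p l else 0)"
      using sq[of l] orth[of l m] sp[of l] by auto
  qed
qed

section \<open>Logarithms and complex powers\<close>

lemma bounded_linear_scaleC_left: "bounded_linear (\<lambda>z. z *\<^sub>C (x :: 'a::cstar_algebra))"
  by (rule bounded_linear_intro[where K = "norm x"])
    (simp_all add: scaleC_add_left scaleR_scaleC scaleC_scaleC norm_scaleC scaleR_conv_of_real)

lemma exp_eigenvector:
  fixes a x :: "'a::cstar_algebra_1"
  assumes "a * x = z *\<^sub>C x"
  shows "exp a * x = exp z *\<^sub>C x"
proof -
  have pow: "a ^ n * x = z ^ n *\<^sub>C x" for n
    by (induction n) (simp_all add: scaleC_one mult.assoc scaleC_mult_right assms scaleC_scaleC power_commutes)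
  have "(\<lambda>n. (a ^ n /\<^sub>R fact n) * x) sums (exp a * x)"
    by (intro sums_mult2 exp_converges)
  moreover have "(\<lambda>n. (z ^ n /\<^sub>R fact n) *\<^sub>C x) sums (exp z *\<^sub>C x)"
    by (intro bounded_linear.sums[OF bounded_linear_scaleC_left] exp_converges)
  moreover have "(a ^ n /\<^sub>R fact n) * x = (z ^ n /\<^sub>R fact n) *\<^sub>C x" for n
    by (simp add: pow scaleR_scaleC scaleC_scaleC scaleR_conv_of_real scaleC_mult_left)
  ultimately show ?thesis by (simp add: sums_unique2)
qed

lemma star_exp: "star (exp a) = exp (star (a :: 'a::cstar_algebra_1))"
proof -
  have "(\<lambda>n. star (a ^ n /\<^sub>R fact n)) sums star (exp a)"
    by (intro bounded_linear.sums[OF bounded_linear_star] exp_converges)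
  then show ?thesis
    using sums_unique2[OF exp_converges[of "star a"]] by (simp add: star_scaleR star_power)
qed

text \<open>Between spectral projections p of h and q of k, h - k acts as l - m and exp h - exp k as
  e^l - e^m. The latter vanishes, so l = m or p q = 0. This is the uniqueness that
  \<open>clog\<close> relies on.\<close>

lemma selfadj_exp_inj:
  assumes fd: "finite_dim TYPE('a::cstar_algebra_1)"
    and h: "star h = (h :: 'a)" and k: "star k = k" and e: "exp h = exp k"
  shows "h = k"
proof -
  obtain S p where S: "finite S" "(\<Sum>l\<in>S. p l) = 1"
    "\<And>l. l \<in> S \<Longrightarrow> h * p l = complex_of_real l *\<^sub>C p l" "\<And>l. l \<in> S \<Longrightarrow> star (p l) = p l"
    using spectral_decomposition[OF fd h] by metis
  obtain T q where T: "finite T" "(\<Sum>l\<in>T. q l) = 1"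
    "\<And>l. l \<in> T \<Longrightarrow> k * q l = complex_of_real l *\<^sub>C q l" "\<And>l. l \<in> T \<Longrightarrow> star (q l) = q l"
    using spectral_decomposition[OF fd k] by metis
  have *: "p l * ((h - k) * q m) = 0" if l: "l \<in> S" and m: "m \<in> T" for l m
  proof -
    have ph: "p l * h = complex_of_real l *\<^sub>C p l"
      using arg_cong[OF S(3)[OF l], of star] by (simp add: star_mult star_scaleC h S(4)[OF l])
    have diff: "p l * ((h - k) * q m) = (complex_of_real l - complex_of_real m) *\<^sub>C (p l * q m)"
    proof -
      have "p l * ((h - k) * q m) = (p l * h) * q m - p l * (k * q m)"
        by (simp add: algebra_simps)
      then show ?thesis
        by (simp add: ph T(3)[OF m] scaleC_mult_left scaleC_mult_right scaleC_diff_left)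
    qed
    have "exp (complex_of_real l) *\<^sub>C (p l * q m) = star (exp h * p l) * q m"
      by (simp add: exp_eigenvector[OF S(3)[OF l]] star_scaleC S(4)[OF l] scaleC_mult_left exp_of_real)
    also have "\<dots> = p l * (exp k * q m)"
      by (simp add: star_mult star_exp h S(4)[OF l] mult.assoc e k)
    also have "\<dots> = exp (complex_of_real m) *\<^sub>C (p l * q m)"
      by (simp add: exp_eigenvector[OF T(3)[OF m]] scaleC_mult_right)
    finally have "(exp l - exp m) *\<^sub>R (p l * q m) = 0"
      by (simp add: scaleR_scaleC scaleC_diff_left flip: exp_of_real)
    then show ?thesis by (auto simp: diff)
  qed
  have "h - k = (\<Sum>l\<in>S. p l) * ((h - k) * (\<Sum>m\<in>T. q m))"
    by (simp add: S(2) T(2))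
  also have "\<dots> = (\<Sum>l\<in>S. \<Sum>m\<in>T. p l * ((h - k) * q m))"
    by (simp only: sum_distrib_left sum_distrib_right) (rule sum.swap)
  also have "\<dots> = 0" using * by simp
  finally show ?thesis by simp
qed

lemma exp_clog:
  assumes fd: "finite_dim TYPE('a::cstar_algebra_1)"
    and Q: "positive (Q :: 'a)" and inv: "R * Q = 1"
  shows "star (clog Q) = clog Q" and "exp (clog Q) = Q"
proof -
  have pQ: "pos Q" using Q by (simp add: positive_def pos_iff)
  obtain S p where S: "finite S" "(\<Sum>l\<in>S. p l) = 1"
    "\<And>l. l \<in> S \<Longrightarrow> Q * p l = complex_of_real l *\<^sub>C p l" "\<And>l. l \<in> S \<Longrightarrow> star (p l) = p l"
    "\<And>l m. l \<in> S \<Longrightarrow> m \<in> S \<Longrightarrow> p l * p m = (if l = m then p l else 0)"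
    using spectral_decomposition[OF fd pos_selfadj[OF pQ]] by metis
  \<comment> \<open>Eigenvalue 0 is excluded by invertibility. For l < 0 both l p and - l p are
    positive, the first as the compression of Q by p.\<close>
  have zero: "p l = 0" if l: "l \<in> S" and "l \<le> 0" for l
  proof (cases "l = 0")
    case True
    then have "Q * p l = 0" using S(3)[OF l] by simp
    then have "R * Q * p l = 0" by (simp add: mult.assoc)
    then show ?thesis by (simp add: inv)
  next
    case False
    obtain x where x: "Q = star x * x" using Q by (auto simp: positive_def)
    have pp: "p l = star (p l) * p l" using S(4,5)[OF l] l by simp
    have "star (x * p l) * (x * p l) = p l * (Q * p l)"
      by (simp add: x star_mult S(4)[OF l] mult.assoc)
    also have "\<dots> = l *\<^sub>R p l"
      using S(5)[OF l l] by (simp add: S(3)[OF l] scaleC_mult_right scaleR_scaleC)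
    finally have "pos (l *\<^sub>R p l)" by (metis pos_star_mult)
    moreover have "pos ((- l) *\<^sub>R p l)"
      by (subst pp, rule pos_scaleR[OF pos_star_mult]) (use that in simp)
    ultimately have "l *\<^sub>R p l = 0"
      by (intro pos_antisym) simp_all
    then show ?thesis using False by simp
  qed
  \<comment> \<open>At l \<le> 0 the value of \<open>ln\<close> is meaningless, but
    \<open>p l\<close> vanishes there.\<close>
  define h where "h = (\<Sum>l\<in>S. ln l *\<^sub>R p l)"
  have h: "star h = h"
    by (simp add: h_def star_sum star_scaleR S(4))
  have hp: "h * p l = complex_of_real (ln l) *\<^sub>C p l" if "l \<in> S" for l
  proof -
    have "h * p l = (\<Sum>m\<in>S. if m = l then ln l *\<^sub>R p l else 0)"
      unfolding h_def sum_distrib_right using S(5) that by (intro sum.cong) auto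
    then show ?thesis using S(1) that by (simp add: scaleR_scaleC)
  qed
  have "exp h = Q"
  proof -
    have *: "exp h * p l = Q * p l" if "l \<in> S" for l
    proof (cases "l > 0")
      case True
      then have "exp (complex_of_real (ln l)) = complex_of_real l"
        by (simp add: exp_of_real)
      then show ?thesis
        using exp_eigenvector[OF hp[OF that]] S(3)[OF that] by simp
    qed (use zero[OF that] in simp)
    have "exp h = (\<Sum>l\<in>S. exp h * p l)"
      by (simp add: S(2) flip: sum_distrib_left)
    also have "\<dots> = (\<Sum>l\<in>S. Q * p l)"
      using * by simp
    also have "\<dots> = Q"
      by (simp add: S(2) flip: sum_distrib_left)
    finally show ?thesis .
  qed
  have "clog Q = h"
    unfolding clog_def
  proof (rule the_equality)
    show "star h = h \<and> exp h = Q" using h \<open>exp h = Q\<close> by simp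
    show "k = h" if "star k = k \<and> exp k = Q" for k
      using selfadj_exp_inj[OF fd, of k h] that h \<open>exp h = Q\<close> by simp
  qed
  then show "star (clog Q) = clog Q" "exp (clog Q) = Q"
    using h \<open>exp h = Q\<close> by auto
qed

lemma cpow_add: "cpow Q (v + w) = cpow Q v * cpow Q w"
  unfolding cpow_def scaleC_add_left
  by (rule exp_add_commuting) (simp add: scaleC_mult_left scaleC_mult_right scaleC_scaleC mult.commute)

lemma cpow_0 [simp]: "cpow Q 0 = 1"
  by (simp add: cpow_def)

section \<open>Matrix units and slices of tensors\<close>

lemma clinear_add: "clinear T \<Longrightarrow> T (a + b) = T a + T b"
  and clinear_scaleC: "clinear T \<Longrightarrow> T (z *\<^sub>C a) = z *\<^sub>C T a"
  by (simp_all add: clinear_iff)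

lemma clinear_0: "clinear T \<Longrightarrow> T 0 = 0"
  using clinear_add[of T 0 0] by simp

lemma clinear_sum: "clinear T \<Longrightarrow> T (sum f A) = (\<Sum>x\<in>A. T (f x))"
  by (induction A rule: infinite_finite_induct) (simp_all add: clinear_0 clinear_add)

text \<open>\<open>e k i j\<close> are the matrix units of the \<open>k\<close>-th block and \<open>cf k i j\<close> the corresponding
  coordinate functionals.\<close>

locale matrix_units =
  fixes r :: nat and d :: "nat \<Rightarrow> nat"
    and e :: "nat \<Rightarrow> nat \<Rightarrow> nat \<Rightarrow> 'b::star_algebra"
    and cf :: "nat \<Rightarrow> nat \<Rightarrow> nat \<Rightarrow> 'b \<Rightarrow> complex"
  assumes d_pos: "k < r \<Longrightarrow> 0 < d k"
    and cf_add: "k < r \<Longrightarrow> i < d k \<Longrightarrow> j < d k \<Longrightarrow> cf k i j (a + b) = cf k i j a + cf k i j b"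
    and cf_scaleC: "k < r \<Longrightarrow> i < d k \<Longrightarrow> j < d k \<Longrightarrow> cf k i j (z *\<^sub>C a) = z * cf k i j a"
    and cf_mult: "k < r \<Longrightarrow> i < d k \<Longrightarrow> j < d k \<Longrightarrow>
      cf k i j (a * b) = (\<Sum>l<d k. cf k i l a * cf k l j b)"
    and cf_star: "k < r \<Longrightarrow> i < d k \<Longrightarrow> j < d k \<Longrightarrow> cf k i j (star a) = cnj (cf k j i a)"
    and cf_unit: "k < r \<Longrightarrow> i < d k \<Longrightarrow> j < d k \<Longrightarrow> k' < r \<Longrightarrow> i' < d k' \<Longrightarrow> j' < d k' \<Longrightarrow>
      cf k i j (e k' i' j') = (if k = k' \<and> i = i' \<and> j = j' then 1 else 0)"
    and cf_ext: "(\<And>k i j. k < r \<Longrightarrow> i < d k \<Longrightarrow> j < d k \<Longrightarrow> cf k i j a = cf k i j b) \<Longrightarrow> a = b"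
begin

lemma cf_0: "k < r \<Longrightarrow> i < d k \<Longrightarrow> j < d k \<Longrightarrow> cf k i j 0 = 0"
  using cf_add[of k i j 0 0] by simp

lemma cf_sum:
  "k < r \<Longrightarrow> i < d k \<Longrightarrow> j < d k \<Longrightarrow> cf k i j (sum f A) = (\<Sum>x\<in>A. cf k i j (f x))"
  by (induction A rule: infinite_finite_induct) (simp_all add: cf_0 cf_add)

lemma sum_delta3:
  fixes f :: "nat \<Rightarrow> nat \<Rightarrow> nat \<Rightarrow> 'x::comm_monoid_add"
  assumes "k < r" "i < d k" "j < d k"
  shows "(\<Sum>k'<r. \<Sum>i'<d k'. \<Sum>j'<d k'. if k = k' \<and> i = i' \<and> j = j' then f k' i' j' else 0) = f k i j"
proof -
  have "(\<Sum>i'<d k'. \<Sum>j'<d k'. if k = k' \<and> i = i' \<and> j = j' then f k' i' j' else 0)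
      = (if k' = k then f k i j else 0)" for k'
  proof (cases "k' = k")
    case True
    have "(\<Sum>i'<d k. \<Sum>j'<d k. if i = i' \<and> j = j' then f k i' j' else 0)
        = (\<Sum>i'<d k. if i' = i then f k i j else 0)"
      using assms by (intro sum.cong) auto
    then show ?thesis using assms(2) unfolding True by simp
  qed auto
  then show ?thesis using assms by simp
qed

lemma expansion: "b = (\<Sum>k<r. \<Sum>i<d k. \<Sum>j<d k. cf k i j b *\<^sub>C e k i j)"
proof (rule cf_ext)
  fix k i j assume *: "k < r" "i < d k" "j < d k"
  have "cf k i j (\<Sum>k<r. \<Sum>i<d k. \<Sum>j<d k. cf k i j b *\<^sub>C e k i j)
      = (\<Sum>k'<r. \<Sum>i'<d k'. \<Sum>j'<d k'. if k = k' \<and> i = i' \<and> j = j' then cf k' i' j' b else 0)"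
    by (simp add: cf_sum cf_scaleC * cf_unit if_distrib[of "\<lambda>x. _ * x"] cong: if_cong)
  also have "\<dots> = cf k i j b" by (rule sum_delta3[OF *])
  finally show "cf k i j b = cf k i j (\<Sum>k<r. \<Sum>i<d k. \<Sum>j<d k. cf k i j b *\<^sub>C e k i j)" ..
qed

lemma unit_mult:
  assumes "k < r" "i < d k" "j < d k" "k' < r" "i' < d k'" "j' < d k'"
  shows "e k i j * e k' i' j' = (if k = k' \<and> j = i' then e k i j' else 0)"
proof (rule cf_ext)
  fix l a b assume *: "l < r" "a < d l" "b < d l"
  have "cf l a b (e k i j * e k' i' j')
      = (\<Sum>m<d l. if m = j then (if l = k \<and> a = i then cf l m b (e k' i' j') else 0) else 0)"
    unfolding cf_mult[OF *] using * assms by (intro sum.cong) (auto simp: cf_unit)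
  then show "cf l a b (e k i j * e k' i' j') = cf l a b (if k = k' \<and> j = i' then e k i j' else 0)"
    using * assms by (auto simp: cf_unit cf_0)
qed

lemma star_unit:
  assumes "k < r" "i < d k" "j < d k" shows "star (e k i j) = e k j i"
  by (rule cf_ext) (auto simp: cf_star cf_unit assms)

text \<open>The trace pairs e_ij with the (j, i) entry; this is where the flipped index pair of the
  Choi sum originates.\<close>

lemma trace_unit:
  assumes "k < r" "i < d k" "j < d k"
  shows "(\<Sum>l<r. \<Sum>m<d l. cf l m m (x * e k i j)) = cf k j i x"
proof -
  have *: "cf l m m (x * e k i j) = (if l = k \<and> m = j then cf k j i x else 0)" if "l < r" "m < d l" for l m
  proof -
    have "cf l m m (x * e k i j) = (\<Sum>n<d l. if n = i then (if l = k \<and> m = j then cf k j i x else 0) else 0)"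
      unfolding cf_mult[OF that(1,2,2)] using that assms by (intro sum.cong) (auto simp: cf_unit)
    then show ?thesis using that assms by auto
  qed
  have "(\<Sum>l<r. \<Sum>m<d l. cf l m m (x * e k i j))
      = (\<Sum>l<r. if l = k then (\<Sum>m<d k. if m = j then cf k j i x else 0) else 0)"
    by (intro sum.cong refl) (auto simp: *)
  then show ?thesis using assms by simp
qed

lemma star_mult_expansion:
  "star a * b = (\<Sum>k<r. \<Sum>j<d k. \<Sum>j'<d k. (\<Sum>i<d k. cnj (cf k i j a) * cf k i j' b) *\<^sub>C e k j j')"
  by (subst expansion) (simp add: cf_mult cf_star)

end

text \<open>The map id tensor f. The guard lets the lifting go through for every f, with the value 0
  where f is not linear and the sum could depend on the representative.\<close>

lift_definition slice :: "('b::complex_vector \<Rightarrow> complex) \<Rightarrow> ('c::complex_vector, 'b) tensor \<Rightarrow> 'c"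
  is "\<lambda>f M. if clinear f then \<Sum>p\<in>#M. f (snd p) *\<^sub>C fst p else 0"
proof -
  fix f :: "'b \<Rightarrow> complex" and M N :: "('c \<times> 'b) multiset"
  assume "tensor_eq M N"
  then have "(\<Sum>p\<in>#M. f (snd p) *\<^sub>C fst p) = (\<Sum>p\<in>#N. f (snd p) *\<^sub>C fst p)" if "clinear f"
    by induction (use that in \<open>auto simp: clinear_iff scaleC_add_left scaleC_add_right
        scaleC_scaleC mult.commute\<close>)
  then show "(if clinear f then \<Sum>p\<in>#M. f (snd p) *\<^sub>C fst p else 0)
      = (if clinear f then \<Sum>p\<in>#N. f (snd p) *\<^sub>C fst p else 0)"
    by simp
qed

lemma slice_0 [simp]: "slice f 0 = 0"
  by transfer simp

lemma slice_add: "slice f (x + y) = slice f x + slice f y"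
  by transfer simp

lemma slice_tensor_elem: "clinear f \<Longrightarrow> slice f (c \<otimes>\<^sub>t b) = f b *\<^sub>C c"
  by transfer simp

lemma slice_sum: "slice f (sum g A) = (\<Sum>x\<in>A. slice f (g x))"
  by (induction A rule: infinite_finite_induct) (simp_all add: slice_add)

lemma tensor_induct [case_names zero elem add]:
  assumes "P 0" and "\<And>a b. P (a \<otimes>\<^sub>t b)" and "\<And>x y. P x \<Longrightarrow> P y \<Longrightarrow> P (x + y)"
  shows "P t"
proof (induction t rule: tensor.abs_induct)
  case (1 M)
  show ?case
  proof (induction M)
    case empty
    show ?case using assms(1) by (simp add: zero_tensor.abs_eq)
  next
    case (add p M)
    have "abs_tensor (add_mset p M) = fst p \<otimes>\<^sub>t snd p + abs_tensor M"
      by (simp add: tensor_elem.abs_eq plus_tensor.abs_eq)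
    then show ?case using assms(2,3) add by simp
  qed
qed

lemma tensor_elem_0_left [simp]: "0 \<otimes>\<^sub>t b = 0"
  using tensor_elem_bilinear(1)[of 0 0 b] by simp

lemma tensor_elem_0_right [simp]: "a \<otimes>\<^sub>t 0 = 0"
  using tensor_elem_bilinear(2)[of a 0 0] by simp

lemma tensor_elem_sum_left: "sum f A \<otimes>\<^sub>t b = (\<Sum>x\<in>A. f x \<otimes>\<^sub>t b)"
  by (induction A rule: infinite_finite_induct) (simp_all add: tensor_elem_bilinear)

lemma tensor_elem_sum_right: "a \<otimes>\<^sub>t sum f A = (\<Sum>x\<in>A. a \<otimes>\<^sub>t f x)"
  by (induction A rule: infinite_finite_induct) (simp_all add: tensor_elem_bilinear)

lemma Opp_algebra:
  "Opp 0 = 0" "Opp (a + b) = Opp a + Opp b" "Opp (z *\<^sub>C a) = z *\<^sub>C Opp a"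
  "Opp a * Opp b = Opp (b * a)" "star (Opp a) = Opp (star a)"
  by (simp_all add: zero_opp_def plus_opp_def scaleC_opp_def times_opp_def star_opp_def)

lemma Opp_sum: "Opp (sum f A) = (\<Sum>x\<in>A. Opp (f x))"
  by (induction A rule: infinite_finite_induct) (simp_all add: Opp_algebra)

section \<open>Twisted coordinates and squares in the tensor product\<close>

context matrix_units
begin

text \<open>Coordinates with respect to the basis \<open>f (e k i j)\<close> of the opposite
  algebra, where g inverts f. Two such bases occur: f b = q b q for the values of the bijection, and
  f b = q b for the roots x of positive elements.\<close>

definition coord :: "('b \<Rightarrow> 'b) \<Rightarrow> nat \<Rightarrow> nat \<Rightarrow> nat \<Rightarrow> ('c::complex_vector, 'b opp) tensor \<Rightarrow> 'c"
  where "coord g k i j = slice (\<lambda>x. cf k i j (g (unopp x)))"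

lemma clinear_coord:
  assumes "clinear g" "k < r" "i < d k" "j < d k"
  shows "clinear (\<lambda>x. cf k i j (g (unopp x)))"
  using assms by (simp add: clinear_iff cf_add cf_scaleC plus_opp_def scaleC_opp_def)

lemma tensor_expansion:
  fixes t :: "('c::complex_vector, 'b opp) tensor"
  assumes f: "clinear f" and g: "clinear g" and fg: "\<And>b. f (g b) = b"
  shows "t = (\<Sum>k<r. \<Sum>i<d k. \<Sum>j<d k. coord g k i j t \<otimes>\<^sub>t Opp (f (e k i j)))"
proof (induction t rule: tensor_induct)
  case zero
  show ?case by (simp add: coord_def)
next
  case (elem c x)
  have "(\<Sum>k<r. \<Sum>i<d k. \<Sum>j<d k. coord g k i j (c \<otimes>\<^sub>t x) \<otimes>\<^sub>t Opp (f (e k i j)))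
      = (\<Sum>k<r. \<Sum>i<d k. \<Sum>j<d k. c \<otimes>\<^sub>t Opp (f (cf k i j (g (unopp x)) *\<^sub>C e k i j)))"
    using f by (intro sum.cong refl) (simp add: coord_def slice_tensor_elem[OF clinear_coord[OF g]]
        tensor_elem_bilinear Opp_algebra clinear_iff)
  also have "\<dots> = c \<otimes>\<^sub>t Opp (f (\<Sum>k<r. \<Sum>i<d k. \<Sum>j<d k. cf k i j (g (unopp x)) *\<^sub>C e k i j))"
    by (simp add: clinear_sum[OF f] Opp_sum tensor_elem_sum_right)
  also have "\<dots> = c \<otimes>\<^sub>t x"
    by (simp add: fg flip: expansion)
  finally show ?case ..
next
  case (add x y)
  have "x + y = (\<Sum>k<r. \<Sum>i<d k. \<Sum>j<d k. coord g k i j x \<otimes>\<^sub>t Opp (f (e k i j)))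
      + (\<Sum>k<r. \<Sum>i<d k. \<Sum>j<d k. coord g k i j y \<otimes>\<^sub>t Opp (f (e k i j)))"
    using add by simp
  also have "\<dots> = (\<Sum>k<r. \<Sum>i<d k. \<Sum>j<d k. coord g k i j (x + y) \<otimes>\<^sub>t Opp (f (e k i j)))"
    by (simp add: coord_def slice_add tensor_elem_bilinear sum.distrib)
  finally show ?case .
qed

lemma coord_sum:
  fixes c :: "nat \<Rightarrow> nat \<Rightarrow> nat \<Rightarrow> 'c::complex_vector"
  assumes g: "clinear g" and gf: "\<And>b. g (f b) = b" and *: "k < r" "i < d k" "j < d k"
  shows "coord g k i j (\<Sum>k<r. \<Sum>i<d k. \<Sum>j<d k. c k i j \<otimes>\<^sub>t Opp (f (e k i j))) = c k i j"
proof -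
  have "coord g k i j (\<Sum>k<r. \<Sum>i<d k. \<Sum>j<d k. c k i j \<otimes>\<^sub>t Opp (f (e k i j)))
      = (\<Sum>k'<r. \<Sum>i'<d k'. \<Sum>j'<d k'. if k = k' \<and> i = i' \<and> j = j' then c k' i' j' else 0)"
    unfolding coord_def slice_sum slice_tensor_elem[OF clinear_coord[OF g *]]
    using * by (intro sum.cong refl) (auto simp: gf cf_unit scaleC_one)
  also have "\<dots> = c k i j" by (rule sum_delta3[OF *])
  finally show ?thesis .
qed

text \<open>In the opposite algebra \<open>e k j i\<close> plays the role of the \<open>(i, j)\<close> matrix unit.\<close>

lemma square_tensor:
  fixes Y :: "nat \<Rightarrow> nat \<Rightarrow> nat \<Rightarrow> 'c::star_algebra"
  assumes q: "star q = q"
  defines "x \<equiv> \<Sum>k<r. \<Sum>j<d k. \<Sum>l<d k. Y k l j \<otimes>\<^sub>t Opp (q * e k j l)"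
  shows "star x * x = (\<Sum>k<r. \<Sum>i<d k. \<Sum>j<d k.
    (\<Sum>l<d k. star (Y k l i) * Y k l j) \<otimes>\<^sub>t Opp (q * e k j i * q))"
proof -
  have "star x = (\<Sum>k<r. \<Sum>i<d k. \<Sum>l<d k. star (Y k l i) \<otimes>\<^sub>t Opp (e k l i * q))"
    unfolding x_def star_sum
    by (intro sum.cong refl) (simp add: tensor_elem_mult_star Opp_algebra star_mult q star_unit)
  then have "star x * x = (\<Sum>k<r. \<Sum>i<d k. \<Sum>l<d k. (star (Y k l i) \<otimes>\<^sub>t Opp (e k l i * q)) * x)"
    by (simp add: sum_distrib_right)
  \<comment> \<open>In the opposite algebra the product of e_li q and q e_jl is q e_jl e_li q = q
    e_ji q, so the one-sided twist of x becomes two-sided.\<close>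
  also have "\<dots> = (\<Sum>k<r. \<Sum>i<d k. \<Sum>l<d k. \<Sum>j<d k.
      (star (Y k l i) * Y k l j) \<otimes>\<^sub>t Opp (q * e k j i * q))"
  proof (intro sum.cong refl)
    fix k i l assume *: "k \<in> {..<r}" "i \<in> {..<d k}" "l \<in> {..<d k}"
    have "(star (Y k l i) \<otimes>\<^sub>t Opp (e k l i * q)) * x
        = (\<Sum>k'<r. \<Sum>j<d k'. \<Sum>l'<d k'. (star (Y k l i) * Y k' l' j) \<otimes>\<^sub>t Opp (q * (e k' j l' * e k l i) * q))"
      by (simp add: x_def sum_distrib_left tensor_elem_mult_star Opp_algebra mult.assoc)
    also have "\<dots> = (\<Sum>k'<r. if k' = k then (\<Sum>j<d k. \<Sum>l'<d k. if l' = l then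
        (star (Y k l i) * Y k l j) \<otimes>\<^sub>t Opp (q * e k j i * q) else 0) else 0)"
    proof (intro sum.cong refl)
      fix k' assume k': "k' \<in> {..<r}"
      have "(star (Y k l i) * Y k' l' j) \<otimes>\<^sub>t Opp (q * (e k' j l' * e k l i) * q)
          = (if k' = k then if l' = l then (star (Y k l i) * Y k l j) \<otimes>\<^sub>t Opp (q * e k j i * q) else 0 else 0)"
        if "j \<in> {..<d k'}" "l' \<in> {..<d k'}" for j l'
        using * k' that by (simp add: unit_mult Opp_algebra)
      then show "(\<Sum>j<d k'. \<Sum>l'<d k'. (star (Y k l i) * Y k' l' j) \<otimes>\<^sub>t Opp (q * (e k' j l' * e k l i) * q))
        = (if k' = k then (\<Sum>j<d k. \<Sum>l'<d k. if l' = l then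
          (star (Y k l i) * Y k l j) \<otimes>\<^sub>t Opp (q * e k j i * q) else 0) else 0)"
        by simp
    qed
    also have "\<dots> = (\<Sum>j<d k. (star (Y k l i) * Y k l j) \<otimes>\<^sub>t Opp (q * e k j i * q))"
      using * by simp
    finally show "(star (Y k l i) \<otimes>\<^sub>t Opp (e k l i * q)) * x
        = (\<Sum>j<d k. (star (Y k l i) * Y k l j) \<otimes>\<^sub>t Opp (q * e k j i * q))" .
  qed
  also have "\<dots> = (\<Sum>k<r. \<Sum>i<d k. \<Sum>j<d k. \<Sum>l<d k.
      (star (Y k l i) * Y k l j) \<otimes>\<^sub>t Opp (q * e k j i * q))"
    by (rule sum.cong[OF refl], rule sum.cong[OF refl], rule sum.swap)
  finally show ?thesis by (simp add: tensor_elem_sum_left)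
qed

section \<open>Complete positivity in terms of matrix units\<close>

lemma sum_Sigma_pair:
  assumes "finite A" "\<And>x. x \<in> A \<Longrightarrow> finite (B x)"
  shows "sum f (Sigma A B) = (\<Sum>x\<in>A. \<Sum>y\<in>B x. f (x, y))"
  using assms by (simp add: sum.Sigma)

lemma mat_star_times_index:
  assumes "X \<in> carrier_mat n n" "p < n" "q < n"
  shows "(mat_star X * X) $$ (p, q) = (\<Sum>m<n. star (X $$ (m, p)) * X $$ (m, q))"
  using assms by (auto simp: mat_star_def scalar_prod_def lessThan_atLeast0 intro!: sum.cong)

text \<open>The matrix \<open>(e k i j)\<^sub>i\<^sub>j\<close> is positive, being the square of its first row.\<close>

lemma completely_positive_imp_gram:
  fixes T :: "'b \<Rightarrow> 'c::cstar_algebra"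
  assumes T: "completely_positive T"
  obtains Y where "\<And>k i j. k < r \<Longrightarrow> i < d k \<Longrightarrow> j < d k \<Longrightarrow>
    T (e k i j) = (\<Sum>l<d k. star (Y k l i) * Y k l j)"
proof -
  have "\<exists>Z. \<forall>i<d k. \<forall>j<d k. T (e k i j) = (\<Sum>l<d k. star (Z l i) * Z l j)" if k: "k < r" for k
  proof -
    define A where "A = mat (d k) (d k) (\<lambda>(i, j). e k i j)"
    \<comment> \<open>A square matrix is required by \<open>positive_mat\<close>, so the row is
      padded with zeros; row 0 exists by \<open>d_pos\<close>.\<close>
    define X where "X = mat (d k) (d k) (\<lambda>(l, j). if l = 0 then e k 0 j else 0)"
    have X: "X \<in> carrier_mat (d k) (d k)" and A: "A \<in> carrier_mat (d k) (d k)"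
      by (simp_all add: X_def A_def)
    have "A = mat_star X * X"
    proof (rule eq_matI)
      fix i j assume "i < dim_row (mat_star X * X)" "j < dim_col (mat_star X * X)"
      then have ij: "i < d k" "j < d k"
        using X by (auto simp: mat_star_def)
      have "(mat_star X * X) $$ (i, j) = (\<Sum>m<d k. if m = 0 then star (e k 0 i) * e k 0 j else 0)"
        unfolding mat_star_times_index[OF X ij] using ij by (intro sum.cong) (auto simp: X_def)
      also have "\<dots> = e k i j"
        using d_pos[OF k] ij k by (simp add: star_unit unit_mult)
      finally show "A $$ (i, j) = (mat_star X * X) $$ (i, j)"
        using ij by (simp add: A_def)
    qed (use X A in \<open>auto simp: mat_star_def\<close>)
    then have "positive_mat (d k) A"
      using X by (auto simp: positive_mat_def)
    then have "positive_mat (d k) (map_mat T A)"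
      using T A by (auto simp: completely_positive_def)
    then obtain Z where Z: "Z \<in> carrier_mat (d k) (d k)" "map_mat T A = mat_star Z * Z"
      by (auto simp: positive_mat_def)
    have "T (e k i j) = (\<Sum>l<d k. star (Z $$ (l, i)) * Z $$ (l, j))" if "i < d k" "j < d k" for i j
      using mat_star_times_index[OF Z(1) that] that unfolding Z(2)[symmetric] by (simp add: A_def)
    then show ?thesis by (intro exI[of _ "\<lambda>l j. Z $$ (l, j)"]) auto
  qed
  then show thesis using that by metis
qed

text \<open>T at \<open>star a * b\<close> becomes a sum of products \<open>star (V a) * V b\<close>
  with V linear, as in a Kraus decomposition. On \<open>star X * X\<close> this gives a Gram matrix
  whose rows are indexed by I, a set of size unrelated to n, whereas \<open>positive_mat\<close>
  asks for n rows; \<open>gram_square\<close> closes this gap.\<close>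

lemma gram_imp_completely_positive:
  fixes T :: "'b \<Rightarrow> 'c::cstar_algebra"
  assumes T: "clinear T"
    and Y: "\<And>k i j. k < r \<Longrightarrow> i < d k \<Longrightarrow> j < d k \<Longrightarrow>
      T (e k i j) = (\<Sum>l<d k. star (Y k l i) * Y k l j)"
  shows "completely_positive T"
proof -
  define V where "V k i l b = (\<Sum>j<d k. cf k i j b *\<^sub>C Y k l j)" for k i l b
  have TV: "T (star a * b) = (\<Sum>k<r. \<Sum>i<d k. \<Sum>l<d k. star (V k i l a) * V k i l b)" for a b
  proof -
    have "T (star a * b) = (\<Sum>k<r. \<Sum>j<d k. \<Sum>j'<d k.
        (\<Sum>i<d k. cnj (cf k i j a) * cf k i j' b) *\<^sub>C T (e k j j'))"
      unfolding star_mult_expansion clinear_sum[OF T] clinear_scaleC[OF T] ..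
    also have "\<dots> = (\<Sum>k<r. \<Sum>j<d k. \<Sum>j'<d k. \<Sum>i<d k. \<Sum>l<d k.
        (cnj (cf k i j a) * cf k i j' b) *\<^sub>C (star (Y k l j) * Y k l j'))"
      by (intro sum.cong refl) (simp add: Y scaleC_sum_left scaleC_sum_right, rule sum.swap)
    also have "\<dots> = (\<Sum>k<r. \<Sum>i<d k. \<Sum>l<d k. \<Sum>j<d k. \<Sum>j'<d k.
        (cnj (cf k i j a) * cf k i j' b) *\<^sub>C (star (Y k l j) * Y k l j'))"
    proof (rule sum.cong[OF refl])
      fix k
      let ?f = "\<lambda>i l j j'. (cnj (cf k i j a) * cf k i j' b) *\<^sub>C (star (Y k l j) * Y k l j')"
      have "(\<Sum>j<d k. \<Sum>j'<d k. \<Sum>i<d k. \<Sum>l<d k. ?f i l j j')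
          = (\<Sum>(j, j')\<in>{..<d k} \<times> {..<d k}. \<Sum>(i, l)\<in>{..<d k} \<times> {..<d k}. ?f i l j j')"
        by (simp flip: sum.cartesian_product)
      also have "\<dots> = (\<Sum>(i, l)\<in>{..<d k} \<times> {..<d k}. \<Sum>(j, j')\<in>{..<d k} \<times> {..<d k}. ?f i l j j')"
        unfolding case_prod_unfold by (rule sum.swap)
      also have "\<dots> = (\<Sum>i<d k. \<Sum>l<d k. \<Sum>j<d k. \<Sum>j'<d k. ?f i l j j')"
        by (simp flip: sum.cartesian_product)
      finally show "(\<Sum>j<d k. \<Sum>j'<d k. \<Sum>i<d k. \<Sum>l<d k. ?f i l j j')
          = (\<Sum>i<d k. \<Sum>l<d k. \<Sum>j<d k. \<Sum>j'<d k. ?f i l j j')" .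
    qed
    also have "\<dots> = (\<Sum>k<r. \<Sum>i<d k. \<Sum>l<d k. star (V k i l a) * V k i l b)"
      by (intro sum.cong refl) (simp add: V_def star_sum star_scaleC sum_product
          scaleC_mult_left scaleC_mult_right scaleC_scaleC mult.commute)
    finally show ?thesis .
  qed
  show ?thesis
    unfolding completely_positive_def
  proof (intro conjI allI ballI impI T)
    fix n and A :: "'b mat"
    assume A: "A \<in> carrier_mat n n" "positive_mat n A"
    then obtain X where X: "X \<in> carrier_mat n n" "A = mat_star X * X"
      by (auto simp: positive_mat_def)
    define I where "I = (SIGMA m:{..<n}. SIGMA k:{..<r}. {..<d k} \<times> {..<d k})"
    define W where "W = (\<lambda>(m, k, i, l) p. V k i l (X $$ (m, p)))"
    have "finite I" by (auto simp: I_def)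
    then obtain Z where Z: "\<And>p q. p < n \<Longrightarrow> q < n \<Longrightarrow>
        (\<Sum>a\<in>I. star (W a p) * W a q) = (\<Sum>m<n. star (Z m p) * Z m q)"
      using gram_square[of I n W] by blast
    have TA: "T (A $$ (p, q)) = (\<Sum>m<n. star (Z m p) * Z m q)" if "p < n" "q < n" for p q
    proof -
      have "T (A $$ (p, q)) = (\<Sum>m<n. \<Sum>k<r. \<Sum>i<d k. \<Sum>l<d k.
          star (V k i l (X $$ (m, p))) * V k i l (X $$ (m, q)))"
        unfolding X(2) mat_star_times_index[OF X(1) that] by (simp add: clinear_sum[OF T] TV)
      also have "\<dots> = (\<Sum>a\<in>I. star (W a p) * W a q)"
        unfolding I_def W_def by (simp add: sum_Sigma_pair)
      finally show ?thesis using Z[OF that] by simp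
    qed
    define Z' where "Z' = mat n n (\<lambda>(m, p). Z m p)"
    have Z': "Z' \<in> carrier_mat n n" by (simp add: Z'_def)
    have "map_mat T A = mat_star Z' * Z'"
    proof (rule eq_matI)
      fix p q assume "p < dim_row (mat_star Z' * Z')" "q < dim_col (mat_star Z' * Z')"
      then have pq: "p < n" "q < n"
        using Z' by (auto simp: mat_star_def)
      show "map_mat T A $$ (p, q) = (mat_star Z' * Z') $$ (p, q)"
        unfolding mat_star_times_index[OF Z' pq] using pq A TA[OF pq] by (auto simp: Z'_def intro!: sum.cong)
    qed (use Z' A in \<open>auto simp: mat_star_def\<close>)
    then show "positive_mat n (map_mat T A)"
      using Z' by (auto simp: positive_mat_def)
  qed
qed

end

section \<open>Matrix units from a block decomposition\<close>

lemma block_isomorphism_matrix_units: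
  fixes \<phi> :: "'b::star_algebra \<Rightarrow> nat \<Rightarrow> complex mat"
  assumes "block_isomorphism r d \<phi>"
  shows "\<exists>e. matrix_units r d e (\<lambda>k i j b. \<phi> b k $$ (i, j))"
proof -
  note \<phi> = assms[unfolded block_isomorphism_def]
  have bij: "bij_betw \<phi> UNIV (\<Pi>\<^sub>E k\<in>{..<r}. carrier_mat (d k) (d k))" using \<phi> by blast
  have car: "\<phi> b k \<in> carrier_mat (d k) (d k)" if "k < r" for b k
    using bij_betwE[OF bij] that by (auto simp: PiE_def Pi_def)
  define E where "E k i j = (\<lambda>k'\<in>{..<r}. mat (d k') (d k') (\<lambda>(a, b). if k' = k \<and> a = i \<and> b = j then 1 else 0 :: complex))" for k i j
  have "E k i j \<in> (\<Pi>\<^sub>E k\<in>{..<r}. carrier_mat (d k) (d k))" for k i j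
    by (auto simp: E_def)
  then have E: "\<phi> (inv_into UNIV \<phi> (E k i j)) = E k i j" for k i j
    using bij by (metis bij_betw_imp_surj_on f_inv_into_f)
  have "matrix_units r d (\<lambda>k i j. inv_into UNIV \<phi> (E k i j)) (\<lambda>k i j b. \<phi> b k $$ (i, j))"
  proof
    show "0 < d k" if "k < r" for k using \<phi> that by blast
    fix a b
    show "\<phi> (a + b) k $$ (i, j) = \<phi> a k $$ (i, j) + \<phi> b k $$ (i, j)" if "k < r" "i < d k" "j < d k" for k i j
      using \<phi> that car[OF that(1), of b] by auto
    show "\<phi> (z *\<^sub>C a) k $$ (i, j) = z * \<phi> a k $$ (i, j)" if "k < r" "i < d k" "j < d k" for k i j z
      using \<phi> that car[OF that(1), of a] by auto
    show "\<phi> (a * b) k $$ (i, j) = (\<Sum>l<d k. \<phi> a k $$ (i, l) * \<phi> b k $$ (l, j))"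
      if "k < r" "i < d k" "j < d k" for k i j
      using \<phi> that car[OF that(1), of a] car[OF that(1), of b]
      by (auto simp: scalar_prod_def lessThan_atLeast0 intro!: sum.cong)
    show "\<phi> (star a) k $$ (i, j) = cnj (\<phi> a k $$ (j, i))" if "k < r" "i < d k" "j < d k" for k i j
      using \<phi> that car[OF that(1), of a] by (auto simp: mat_star_def)
    show "\<phi> (inv_into UNIV \<phi> (E k' i' j')) k $$ (i, j) = (if k = k' \<and> i = i' \<and> j = j' then 1 else 0)"
      if "k < r" "i < d k" "j < d k" for k i j k' i' j'
      unfolding E using that by (auto simp: E_def)
    show "a = b" if "\<And>k i j. k < r \<Longrightarrow> i < d k \<Longrightarrow> j < d k \<Longrightarrow> \<phi> a k $$ (i, j) = \<phi> b k $$ (i, j)"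
    proof -
      \<comment> \<open>Beyond the last block both sides are \<open>undefined\<close>, as the range
        consists of extensional functions.\<close>
      have "\<phi> a k = \<phi> b k" for k
      proof (cases "k < r")
        case True
        then show ?thesis using car[OF True, of a] car[OF True, of b] that[OF True] by (intro eq_matI) auto
      next
        case False
        then show ?thesis using bij_betwE[OF bij] by (auto simp: PiE_def extensional_def)
      qed
      then show ?thesis using bij by (metis bij_betw_imp_inj_on injD ext)
    qed
  qed
  then show ?thesis by blast
qed

section \<open>The bijection\<close>

text \<open>Nonnegativity of the variance of x bounds |psi x|^2 by psi at \<open>star x * x\<close>,
  and the squared norm of x minus \<open>star x * x\<close> is itself a square. Boundedness is what
  puts the maps \<open>theta\<close> into the type \<open>cblin\<close>.\<close>

lemma faithful_state_bounded:
  fixes \<psi> :: "'b::cstar_algebra_1 \<Rightarrow> complex"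
  assumes "faithful_state \<psi>" shows "cmod (\<psi> x) \<le> norm x"
proof -
  have lin: "\<psi> (a + b) = \<psi> a + \<psi> b" "\<psi> (z *\<^sub>C a) = z * \<psi> a" for a b z
    using assms by (simp_all add: faithful_state_def clinear_iff)
  have diff: "\<psi> (a - b) = \<psi> a - \<psi> b" for a b
    using lin(1)[of "a - b" b] by simp
  have nn: "0 \<le> Re (\<psi> (star a * a))" "Im (\<psi> (star a * a)) = 0" for a
    using assms by (auto simp: faithful_state_def less_eq_complex_def)
  have one: "\<psi> 1 = 1" using assms by (simp add: faithful_state_def)
  have ex: "\<psi> (star (x + z *\<^sub>C 1) * (x + z *\<^sub>C 1))
      = \<psi> (star x * x) + z * \<psi> (star x) + cnj z * \<psi> x + cnj z * z" for z
    by (simp add: star_add star_scaleC distrib_left distrib_right scaleC_mult_left scaleC_mult_right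
        scaleC_scaleC lin one)
  \<comment> \<open>The cross terms at z = 1 and z = i are real; they compare the imaginary and the
    real parts, respectively.\<close>
  have "\<psi> (star x) = cnj (\<psi> x)"
    using nn(2)[of "x + 1 *\<^sub>C 1"] nn(2)[of "x + \<i> *\<^sub>C 1"] nn(2)[of x]
    unfolding ex by (simp add: complex_eq_iff)
  then have "\<psi> (star (x + (- \<psi> x) *\<^sub>C 1) * (x + (- \<psi> x) *\<^sub>C 1)) = \<psi> (star x * x) - \<psi> x * cnj (\<psi> x)"
    unfolding ex by simp
  then have "(cmod (\<psi> x))\<^sup>2 \<le> Re (\<psi> (star x * x))"
    using nn(1)[of "x + (- \<psi> x) *\<^sub>C 1"] by (simp add: complex_mult_cnj cmod_power2)
  also have "\<dots> \<le> (norm x)\<^sup>2"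
  proof -
    have "pos ((norm x)\<^sup>2 *\<^sub>R 1 - star x * x)"
      by (rule pos_one_minus) (simp_all add: star_mult cstar_identity)
    then obtain y where "(norm x)\<^sup>2 *\<^sub>R 1 - star x * x = star y * y"
      by (auto simp: pos_iff)
    then have "0 \<le> Re (\<psi> ((norm x)\<^sup>2 *\<^sub>R 1 - star x * x))"
      using nn(1)[of y] by simp
    then show ?thesis by (simp add: diff scaleR_scaleC lin one)
  qed
  finally show ?thesis by (rule power2_le_imp_le) simp
qed

lemma cblin_apply_clinear: "clinear (cblin_apply T)"
  using cblin_apply[of T] by simp

lemma cblin_apply_theta:
  assumes "faithful_state \<psi>"
  shows "cblin_apply (theta \<psi> a c) b = \<psi> (a * b) *\<^sub>C c"
proof -
  have \<psi>: "clinear \<psi>" using assms by (simp add: faithful_state_def)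
  then have "clinear (\<lambda>b. \<psi> (a * b) *\<^sub>C c)"
    by (simp add: clinear_iff distrib_left scaleC_mult_right scaleC_add_left scaleC_scaleC)
  moreover have "bounded_linear (\<lambda>b. \<psi> (a * b) *\<^sub>C c)"
  proof (rule bounded_linear_intro[where K = "norm a * norm c"])
    fix x y and s :: real
    show "\<psi> (a * (x + y)) *\<^sub>C c = \<psi> (a * x) *\<^sub>C c + \<psi> (a * y) *\<^sub>C c"
      "\<psi> (a * s *\<^sub>R x) *\<^sub>C c = s *\<^sub>R (\<psi> (a * x) *\<^sub>C c)"
      using \<psi> by (simp_all add: clinear_iff distrib_left scaleC_add_left scaleR_scaleC
          scaleC_mult_right scaleC_scaleC)
    have "cmod (\<psi> (a * x)) \<le> norm a * norm x"
      by (rule order_trans[OF faithful_state_bounded[OF assms] norm_mult_ineq])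
    then show "norm (\<psi> (a * x) *\<^sub>C c) \<le> norm x * (norm a * norm c)"
      using mult_right_mono[OF _ norm_ge_zero[of c]] by (fastforce simp: norm_scaleC mult_ac)
  qed
  ultimately show ?thesis
    unfolding theta_def by (subst Cblin_inverse) auto
qed

lemma cblin_apply_sum: "cblin_apply (sum f A) b = (\<Sum>x\<in>A. cblin_apply (f x) b)"
  by (induction A rule: infinite_finite_induct) (simp_all add: zero_cblin.rep_eq plus_cblin.rep_eq)

lemma cblin_eqI: "(\<And>b. cblin_apply S b = cblin_apply T b) \<Longrightarrow> S = T"
  by (simp add: cblin_apply_inject[symmetric] fun_eq_iff)

lemma (in matrix_units) trace_commute:
  "(\<Sum>k<r. \<Sum>m<d k. cf k m m (a * b)) = (\<Sum>k<r. \<Sum>m<d k. cf k m m (b * a))"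
proof (rule sum.cong[OF refl])
  fix k assume "k \<in> {..<r}"
  then show "(\<Sum>m<d k. cf k m m (a * b)) = (\<Sum>m<d k. cf k m m (b * a))"
    by (simp add: cf_mult mult.commute[of "cf k _ _ a"]) (rule sum.swap)
qed

lemma is_block_trace_matrix_units:
  assumes "is_block_trace Tr"
  obtains r d e cf where "matrix_units r d e cf"
    "\<And>a. Tr a = (\<Sum>k<r. \<Sum>m<d k. cf k m m a)"
proof -
  obtain r d \<phi> where \<phi>: "block_isomorphism r d \<phi>" and Tr: "\<And>a. Tr a = (\<Sum>k<r. mat_trace (\<phi> a k))"
    using assms by (auto simp: is_block_trace_def)
  obtain e where "matrix_units r d e (\<lambda>k i j b. \<phi> b k $$ (i, j))"
    using block_isomorphism_matrix_units[OF \<phi>] by blast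
  moreover have "dim_row (\<phi> a k) = d k" if "k < r" for a k
    using \<phi> that bij_betwE[of \<phi>] by (fastforce simp: block_isomorphism_def PiE_def Pi_def)
  then have "Tr a = (\<Sum>k<r. \<Sum>m<d k. \<phi> a k $$ (m, m))" for a
    by (simp add: Tr mat_trace_def)
  ultimately show thesis by (rule that)
qed

theorem theorem5p36:
  fixes \<psi> Tr :: "'b::cstar_algebra_1 \<Rightarrow> complex" and Q :: 'b
  assumes "finite_dim TYPE('b)"
    and "faithful_state \<psi>"
    and "is_block_trace Tr"
    and "positive Q" and "\<exists>R. Q * R = 1 \<and> R * Q = 1" and "\<forall>a. \<psi> a = Tr (Q * a)"
  defines "is_Psi' \<equiv> \<lambda>\<Psi> :: ('b, 'c::cstar_algebra) cblin \<Rightarrow> ('c, 'b opp) tensor.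
      clinear \<Psi> \<and> (\<forall>a c. \<Psi> (theta \<psi> a c) = c \<otimes>\<^sub>t Opp (modular Q (- \<i> / 2) a))"
  shows "(\<exists>!\<Psi>. is_Psi' \<Psi>) \<and>
    (\<forall>\<Psi>. is_Psi' \<Psi> \<longrightarrow> bij_betw \<Psi> {T. completely_positive (cblin_apply T)} {e. positive e})"
proof -
  note theta = cblin_apply_theta[OF assms(2)]
  obtain R where R: "Q * R = 1" "R * Q = 1" using assms(5) by blast
  obtain r d and e :: "nat \<Rightarrow> nat \<Rightarrow> nat \<Rightarrow> 'b" and cf where mu: "matrix_units r d e cf"
    and Tr: "\<And>a. Tr a = (\<Sum>k<r. \<Sum>m<d k. cf k m m a)"
    using is_block_trace_matrix_units[OF assms(3)] by blast
  interpret matrix_units r d e cf by (rule mu)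
  define q where "q = cpow Q (- (1 / 2))"
  define q' where "q' = cpow Q (1 / 2)"
  have qq: "q * q' = 1" "q' * q = 1"
    by (simp_all add: q_def q'_def flip: cpow_add)
  have qQ: "q * Q = q'"
  proof -
    have "Q = cpow Q 1"
      by (simp add: cpow_def scaleC_one exp_clog[OF assms(1,4) R(2)])
    then have "q * Q = cpow Q (- (1 / 2) + 1)"
      unfolding cpow_add q_def by simp
    then show ?thesis by (simp add: q'_def)
  qed
  have q_star: "star q = q"
    by (simp add: q_def cpow_def star_exp star_scaleC exp_clog[OF assms(1,4) R(2)])
  \<comment> \<open>At z = -i/2 the exponent i z is 1/2.\<close>
  have modular: "modular Q (- \<i> / 2) a = q' * a * q" for a
    by (simp add: modular_def q_def q'_def)
  define f where "f b = q * b * q" for b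
  define g where "g b = q' * b * q'" for b
  have lin: "clinear f" "clinear g" "clinear (\<lambda>b. q * b)" "clinear (\<lambda>b. q' * b)"
    by (simp_all add: clinear_iff f_def g_def scaleC_mult_left scaleC_mult_right algebra_simps)
  have inverse: "q' * (q * b) = b" "q * (q' * b) = b" for b
    by (simp_all add: qq flip: mult.assoc)
  have gf: "g (f b) = b" for b
    by (simp add: f_def g_def mult.assoc inverse qq)
  have \<psi>1: "\<psi> (a * e k i j) = cf k j i (Q * a)" if "k < r" "i < d k" "j < d k" for a k i j
    using trace_unit[OF that, of "Q * a"] assms(6) by (simp add: Tr mult.assoc)
  \<comment> \<open>R is the inverse of Q and cancels the density, so R e_ji represents the (i, j)
    coordinate. Hence the \<open>theta\<close> maps span, which is the source of uniqueness.\<close>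
  have \<psi>2: "\<psi> (R * e k j i * b) = cf k i j b" if "k < r" "i < d k" "j < d k" for b k i j
  proof -
    have "\<psi> (R * e k j i * b) = Tr (e k j i * b)"
      using assms(6) by (simp add: R(1) flip: mult.assoc)
    then show ?thesis
      using trace_unit[of k j i b] trace_commute[of b "e k j i"] that by (simp add: Tr)
  qed

  define \<Psi>0 :: "('b, 'c) cblin \<Rightarrow> ('c, 'b opp) tensor" where
    "\<Psi>0 T = (\<Sum>k<r. \<Sum>i<d k. \<Sum>j<d k. cblin_apply T (e k i j) \<otimes>\<^sub>t Opp (q * e k j i * q))" for T
  have \<Psi>0_lin: "clinear \<Psi>0"
    by (simp add: clinear_iff \<Psi>0_def plus_cblin.rep_eq scaleC_cblin.rep_eq tensor_elem_bilinear
        sum.distrib scaleC_sum_right)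
  have \<Psi>0_theta: "\<Psi>0 (theta \<psi> a c) = c \<otimes>\<^sub>t Opp (modular Q (- \<i> / 2) a)" for a c
  proof -
    have "\<Psi>0 (theta \<psi> a c) = (\<Sum>k<r. \<Sum>i<d k. \<Sum>j<d k. c \<otimes>\<^sub>t Opp (f (cf k j i (Q * a) *\<^sub>C e k j i)))"
      unfolding \<Psi>0_def theta
      by (intro sum.cong refl) (simp add: \<psi>1 clinear_scaleC[OF lin(1)] Opp_algebra tensor_elem_bilinear,
          simp add: f_def)
    also have "\<dots> = (\<Sum>k<r. \<Sum>j<d k. \<Sum>i<d k. c \<otimes>\<^sub>t Opp (f (cf k j i (Q * a) *\<^sub>C e k j i)))"
      by (rule sum.cong[OF refl], rule sum.swap)
    also have "\<dots> = c \<otimes>\<^sub>t Opp (f (\<Sum>k<r. \<Sum>j<d k. \<Sum>i<d k. cf k j i (Q * a) *\<^sub>C e k j i))"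
      by (simp add: clinear_sum[OF lin(1)] Opp_sum tensor_elem_sum_right)
    also have "\<dots> = c \<otimes>\<^sub>t Opp (f (Q * a))"
      by (simp flip: expansion)
    finally show ?thesis
      unfolding modular f_def by (simp add: qQ flip: mult.assoc)
  qed
  \<comment> \<open>The map with prescribed values on the matrix units. As a sum of
    \<open>theta\<close> maps it lies in \<open>cblin\<close> from the start, and every candidate
    for the bijection is determined on it.\<close>
  define comb :: "(nat \<Rightarrow> nat \<Rightarrow> nat \<Rightarrow> 'c) \<Rightarrow> ('b, 'c) cblin" where
    "comb S = (\<Sum>k<r. \<Sum>i<d k. \<Sum>j<d k. theta \<psi> (R * e k j i) (S k i j))" for S
  have comb_apply: "cblin_apply (comb S) b = (\<Sum>k<r. \<Sum>i<d k. \<Sum>j<d k. cf k i j b *\<^sub>C S k i j)" for S b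
    by (simp add: comb_def cblin_apply_sum theta \<psi>2)
  have comb_unit: "cblin_apply (comb S) (e k i j) = S k i j" if "k < r" "i < d k" "j < d k" for S k i j
  proof -
    have "cblin_apply (comb S) (e k i j)
        = (\<Sum>k'<r. \<Sum>i'<d k'. \<Sum>j'<d k'. if k = k' \<and> i = i' \<and> j = j' then S k' i' j' else 0)"
      unfolding comb_apply using that by (intro sum.cong refl) (auto simp: cf_unit scaleC_one)
    then show ?thesis by (simp add: sum_delta3[OF that])
  qed
  have comb_expansion: "comb (\<lambda>k i j. cblin_apply T (e k i j)) = T" for T
  proof (rule cblin_eqI)
    fix b
    have "cblin_apply T b = cblin_apply T (\<Sum>k<r. \<Sum>i<d k. \<Sum>j<d k. cf k i j b *\<^sub>C e k i j)"
      by (simp flip: expansion)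
    then show "cblin_apply (comb (\<lambda>k i j. cblin_apply T (e k i j))) b = cblin_apply T b"
      by (simp add: comb_apply clinear_sum[OF cblin_apply_clinear] clinear_scaleC[OF cblin_apply_clinear])
  qed
  have unique: "\<Psi> = \<Psi>0" if "is_Psi' \<Psi>" for \<Psi>
  proof
    fix T
    have \<Psi>: "clinear \<Psi>" "\<And>a c. \<Psi> (theta \<psi> a c) = \<Psi>0 (theta \<psi> a c)"
      using that by (auto simp: is_Psi'_def \<Psi>0_theta)
    have "\<Psi> (comb S) = \<Psi>0 (comb S)" for S
      by (simp add: comb_def clinear_sum[OF \<Psi>(1)] clinear_sum[OF \<Psi>0_lin] \<Psi>(2))
    then show "\<Psi> T = \<Psi>0 T" by (metis comb_expansion)
  qed
  have inj: "inj \<Psi>0"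
  proof (rule injI)
    fix S T assume eq: "\<Psi>0 S = \<Psi>0 T"
    \<comment> \<open>After exchanging i and j, the coordinate (k, j, i) with respect to q e_ji q
      recovers T at e_ij, and these values determine T.\<close>
    have "\<Psi>0 T = (\<Sum>k<r. \<Sum>i<d k. \<Sum>j<d k. cblin_apply T (e k j i) \<otimes>\<^sub>t Opp (f (e k i j)))" for T
      unfolding \<Psi>0_def f_def by (rule sum.cong[OF refl], rule sum.swap)
    then have "coord g k j i (\<Psi>0 T) = cblin_apply T (e k i j)"
      if "k < r" "i < d k" "j < d k" for T k i j
      using coord_sum[OF lin(2) gf that(1,3,2), of "\<lambda>k i j. cblin_apply T (e k j i)"] by simp
    then have *: "cblin_apply S (e k i j) = cblin_apply T (e k i j)" if "k < r" "i < d k" "j < d k" for k i j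
      using that eq by metis
    have "comb (\<lambda>k i j. cblin_apply S (e k i j)) = comb (\<lambda>k i j. cblin_apply T (e k i j))"
      unfolding comb_def by (intro sum.cong refl) (simp add: *)
    then show "S = T" by (simp add: comb_expansion)
  qed
  have \<Psi>0_gram: "\<Psi>0 T = star x * x"
    if "x = (\<Sum>k<r. \<Sum>j<d k. \<Sum>l<d k. Y k l j \<otimes>\<^sub>t Opp (q * e k j l))"
      and "\<And>k i j. k < r \<Longrightarrow> i < d k \<Longrightarrow> j < d k \<Longrightarrow>
        cblin_apply T (e k i j) = (\<Sum>l<d k. star (Y k l i) * Y k l j)" for T x Y
    unfolding that(1) square_tensor[OF q_star] \<Psi>0_def
    by (intro sum.cong refl) (simp add: that(2))
  have "\<Psi>0 ` {T. completely_positive (cblin_apply T)} = {e. positive e}"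
  proof (intro equalityI subsetI)
    fix t assume "t \<in> \<Psi>0 ` {T. completely_positive (cblin_apply T)}"
    then obtain T where T: "completely_positive (cblin_apply T)" "t = \<Psi>0 T" by blast
    obtain Y where "\<And>k i j. k < r \<Longrightarrow> i < d k \<Longrightarrow> j < d k \<Longrightarrow>
        cblin_apply T (e k i j) = (\<Sum>l<d k. star (Y k l i) * Y k l j)"
      using completely_positive_imp_gram[OF T(1)] by blast
    from \<Psi>0_gram[OF refl this] show "t \<in> {e. positive e}"
      unfolding T(2) positive_def by blast
  next
    fix t :: "('c, 'b opp) tensor" assume "t \<in> {e. positive e}"
    then obtain x where x: "t = star x * x" by (auto simp: positive_def)
    \<comment> \<open>The indices l and j are exchanged to match \<open>square_tensor\<close>, where
      Y k l j is the coefficient of q e_jl.\<close>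
    define Y where "Y k l j = coord (\<lambda>b. q' * b) k j l x" for k l j
    have x_exp: "x = (\<Sum>k<r. \<Sum>j<d k. \<Sum>l<d k. Y k l j \<otimes>\<^sub>t Opp (q * e k j l))"
      unfolding Y_def by (rule tensor_expansion[OF lin(3,4)]) (simp add: inverse)
    define T where "T = comb (\<lambda>k i j. \<Sum>l<d k. star (Y k l i) * Y k l j)"
    have T: "cblin_apply T (e k i j) = (\<Sum>l<d k. star (Y k l i) * Y k l j)"
      if "k < r" "i < d k" "j < d k" for k i j
      using that by (simp add: T_def comb_unit)
    have "completely_positive (cblin_apply T)"
      by (rule gram_imp_completely_positive[OF cblin_apply_clinear T])
    moreover have "\<Psi>0 T = t"
      unfolding x by (rule \<Psi>0_gram[OF x_exp T])
    ultimately show "t \<in> \<Psi>0 ` {T. completely_positive (cblin_apply T)}" by blast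
  qed
  then have "bij_betw \<Psi>0 {T. completely_positive (cblin_apply T)} {e. positive e}"
    using inj_on_subset[OF inj subset_UNIV] by (simp add: bij_betw_def)
  moreover have "is_Psi' \<Psi>0"
    by (simp add: is_Psi'_def \<Psi>0_lin \<Psi>0_theta)
  ultimately show ?thesis using unique by blast
qed

end
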